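(* Let $c\in[0,1)$, $b:=\tfrac12-c$, $f_c(x)=\log|\cos\pi(x+c)|$, and $$\alpha(c):=\inf_{\mu\in\mathcal M_T}\int_{\mathbb T} f_c\,d\mu,\qquad m_c^*:=\liminf_{n\to\infty}\frac1n\sum_{k=1}^n\log|\sin\pi(2^kb-b)|.$$ Then: (1) For any $c\in[0,1)$, $\alpha(c)=-\infty$ if and only if $m_c^*=-\infty$. (2) If $\tfrac12-c$ is a periodic point of $T$, then $\alpha(c)=-\infty$. (3) If $\tfrac12-c$ is pre-periodic but not periodic for $T$, then $\alpha(c)>-\infty$. (4) The set of $c\in[0,1)$ such that $\alpha(c)=-\infty$ is a residual set (its complement is of first Baire category). (5) For Lebesgue almost every $c\in[0,1)$, $m_c^*=-\log 2$. (6) $\dim_H\{c\in[0,1):\alpha(c)=-\infty\}=0$.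
   Context: $\mathbb T=\mathbb R/\mathbb Z$ and $T:\mathbb T\to\mathbb T$ is the doubling map $Tx=2x \bmod 1$. $\mathcal M_T$ denotes the set of $T$-invariant Borel probability measures on $\mathbb T$. Note $f_c(x)=\log|\sin\pi(x-b)|$ with $b=\tfrac12-c$, and $f_c(b)=-\infty$; the convention $\log 0=-\infty$ is used. $\dim_H$ is Hausdorff dimension. *)

theory Defs
  imports "HOL-Analysis.Analysis" "HOL-Probability.Probability"
begin

text \<open>The circle T = R/Z is represented by reals; the doubling map is x \<mapsto> frac (2x).
  A Borel probability measure on the real line invariant under this map is automatically
  concentrated on [0,1) (since the preimage of [0,1) is all of R), so these are exactly
  the T-invariant Borel probability measures on the circle.\<close>

definition dbl :: "real \<Rightarrow> real" where
  "dbl x = frac (2 * x)"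

definition invariant_measures :: "real measure set" where
  "invariant_measures = {M. sets M = sets borel \<and> prob_space M \<and> distr M borel dbl = M}"

definition fc :: "real \<Rightarrow> real \<Rightarrow> ereal" where
  "fc c x = (if cos (pi * (x + c)) = 0 then - \<infinity> else ereal (ln \<bar>cos (pi * (x + c))\<bar>))"

text \<open>Since f_c \<le> 0, its integral (in [-infinity,0]) is minus the integral of -f_c.\<close>
definition integral_fc :: "real \<Rightarrow> real measure \<Rightarrow> ereal" where
  "integral_fc c M = - enn2ereal (\<integral>\<^sup>+ x. e2ennreal (- fc c x) \<partial>M)"

definition alpha :: "real \<Rightarrow> ereal" where
  "alpha c = (INF M \<in> invariant_measures. integral_fc c M)"

definition logsin :: "real \<Rightarrow> ereal" where
  "logsin x = (if sin (pi * x) = 0 then - \<infinity> else ereal (ln \<bar>sin (pi * x)\<bar>))"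

definition mstar :: "real \<Rightarrow> ereal" where
  "mstar c = (let b = 1/2 - c in
     liminf (\<lambda>n::nat. ereal (1 / real n) * (\<Sum>k=1..n. logsin (2^k * b - b))))"

definition periodic_pt :: "real \<Rightarrow> bool" where
  "periodic_pt b \<longleftrightarrow> (\<exists>p>0. (dbl ^^ p) (frac b) = frac b)"

definition preperiodic_pt :: "real \<Rightarrow> bool" where
  "preperiodic_pt b \<longleftrightarrow> (\<exists>n p. p > 0 \<and> (dbl ^^ (n + p)) (frac b) = (dbl ^^ n) (frac b))"

definition meagre_in :: "'a topology \<Rightarrow> 'a set \<Rightarrow> bool" where
  "meagre_in X S \<longleftrightarrow> (\<exists>F :: nat \<Rightarrow> 'a set. S \<subseteq> (\<Union>n. F n) \<and>
      (\<forall>n. F n \<subseteq> topspace X \<and> X interior_of (X closure_of F n) = {}))"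

definition hausdorff_content :: "real \<Rightarrow> real \<Rightarrow> real set \<Rightarrow> ennreal" where
  "hausdorff_content s \<delta> A =
     (INF U \<in> {U :: nat \<Rightarrow> real set. A \<subseteq> (\<Union>i. U i) \<and>
                 (\<forall>i. bounded (U i) \<and> diameter (U i) \<le> \<delta>)}.
        (\<Sum>i. ennreal (diameter (U i) powr s)))"

definition hausdorff_measure :: "real \<Rightarrow> real set \<Rightarrow> ennreal" where
  "hausdorff_measure s A = (SUP \<delta> \<in> {0<..}. hausdorff_content s \<delta> A)"

definition hausdorff_dim :: "real set \<Rightarrow> real" where
  "hausdorff_dim A = Inf {s. s \<ge> 0 \<and> hausdorff_measure s A = 0}"

end

(* Write b = 1/2 - c, so that f_c(x) = ln |sin pi (x - b)|, and measure distances on the circle by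
   d(x,y) = |sin pi (x - y)|. All parts rest on the condition that the return sums
   S(n) = - sum of ln d(2^k b, b) over k = 1..n grow at most linearly; this is m_c^* > -infinity.

   If S(n) <= L n, cut any orbit at the first time it is too close to b to be compared with the
   orbit of b itself; each piece of length t costs at most O(t), which bounds truncated Birkhoff
   sums uniformly and hence all integrals. Conversely, if all periodic orbits have bounded averages,
   then d(2^k b, b) decays at most exponentially, and shadowing orbit segments of b by periodic
   points bounds S(n), the segments near the close approaches shrinking geometrically.

   For the dimension, if S is not linearly bounded then at infinitely many scales n the first n
   binary digits of b consist, up to a small proportion, of long copies of their own prefixes;
   there are subexponentially many such words. For almost every b, the functions
   ln |2 sin pi (2^k - 1) x| are almost orthogonal, because averaging over x + i/p and the product
   formula for sines give correlation 1/(p q) to the dilations by coprime p and q. *)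

theory Submission
  imports Defs "HOL-Computational_Algebra.Polynomial" "HOL-Library.Discrete_Functions"
begin

section \<open>The distance on the circle and shadowing\<close>

text \<open>The linear bound on S cannot be read off from one periodic orbit: shadowing compares
  logarithms only while the orbit stays farther from \<open>b\<close> than the shadowing error, so
  it breaks down exactly at the close approaches that dominate the sum. Restarting there would
  repeat an uncontrolled cost at every level. Therefore the weaker bound \<open>slow_return\<close>
  is proved first: it bounds the length of a restarted piece by a multiple of the time already used,
  and leaves a single deep approach to be paid for. The same escape-time argument, with a minimal
  block length \<open>M\<close>, becomes a coding device for the dimension: a growth constant
  \<open>\<sigma>\<close> is charged on copied digits only, so failure of linear growth forces most
  digits to be copied. Exact returns need care throughout: \<open>ln 0 = 0\<close> hides the
  singularity, hence positivity of distances is a separate clause and integrals go through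
  truncations. In the almost sure statement the second moments are summable only along squares;
  monotonicity of S fills the gaps.\<close>

definition sd :: "real \<Rightarrow> real" where
  "sd x = \<bar>sin (pi * x)\<bar>"

lemma sd_nonneg [simp]: "0 \<le> sd x" and sd_le_1 [simp]: "sd x \<le> 1"
  by (auto simp: sd_def)

lemma sd_add: "sd (x + y) \<le> sd x + sd y"
proof -
  have "sd (x + y) \<le> \<bar>sin (pi * x)\<bar> * \<bar>cos (pi * y)\<bar> + \<bar>cos (pi * x)\<bar> * \<bar>sin (pi * y)\<bar>"
    by (metis (no_types, lifting) abs_mult abs_triangle_ineq distrib_left sd_def sin_add)
  also have "\<dots> \<le> sd x * 1 + 1 * sd y"
    unfolding sd_def by (intro add_mono mult_mono) auto
  finally show ?thesis by simp
qed

lemma sd_minus [simp]: "sd (- x) = sd x"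
  by (simp add: sd_def)

lemma sd_commute: "sd (x - y) = sd (y - x)"
  by (metis minus_diff_eq sd_minus)

lemma sd_mult_nat: "sd (real n * x) \<le> real n * sd x"
proof (induction n)
  case (Suc n)
  have "sd (real (Suc n) * x) \<le> sd (real n * x) + sd x"
    using sd_add[of "real n * x" x] by (simp add: algebra_simps)
  with Suc show ?case by (simp add: algebra_simps)
qed (simp add: sd_def)

lemma sd_mult_power2: "sd (2 ^ n * x) \<le> 2 ^ n * sd x"
  using sd_mult_nat[of "2 ^ n" x] by simp

lemma sd_eq_0_iff: "sd x = 0 \<longleftrightarrow> x \<in> \<int>"
proof -
  have "sin (pi * x) = 0 \<longleftrightarrow> (\<exists>i::int. x = of_int i)"
    unfolding sin_zero_iff_int2 by (auto simp: mult.commute)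
  then show ?thesis by (auto simp: sd_def Ints_def)
qed

lemma sd_add_Ints: "k \<in> \<int> \<Longrightarrow> sd (x + k) = sd x"
  using sd_add[of x k] sd_add[of "x + k" "- k"] sd_eq_0_iff[of k] by simp

lemma sd_cong_Ints: "x - y \<in> \<int> \<Longrightarrow> sd x = sd y"
  using sd_add_Ints[of "x - y" y] by simp

lemma sd_le_pi: "sd x \<le> pi * \<bar>x\<bar>"
  using abs_sin_x_le_abs_x[of "pi * x"] by (simp add: sd_def abs_mult)

lemma sin_ge_linear:
  fixes x :: real
  assumes "0 \<le> x" "x \<le> 1/2"
  shows "2 * x \<le> sin (pi * x)"
proof -
  have "concave_on {0..pi} (sin :: real \<Rightarrow> real)"
    unfolding concave_on_def
  proof (rule f''_ge0_imp_convex[where f' = "\<lambda>x. - cos x" and f'' = sin])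
    show "convex {0..pi}" by simp
  qed (auto intro!: derivative_eq_intros sin_ge_zero)
  then have "(1 - 2 * x) * sin 0 + 2 * x * sin (pi / 2) \<le> sin ((1 - 2 * x) * 0 + 2 * x * (pi / 2))"
    using assms concave_onD[of "{0..pi}" sin "2 * x" 0 "pi / 2"] by simp
  then show ?thesis by (simp add: mult.commute)
qed

lemma sd_ge_linear: "\<bar>x\<bar> \<le> 1/2 \<Longrightarrow> 2 * \<bar>x\<bar> \<le> sd x"
  using sin_ge_linear[of "\<bar>x\<bar>"] by (cases "x \<ge> 0") (auto simp: sd_def)

lemma sd_round: "2 * \<bar>x - of_int (round x)\<bar> \<le> sd x"
proof -
  have "\<bar>x - of_int (round x)\<bar> \<le> 1/2"
    using of_int_round_abs_le[of x] by (simp add: abs_minus_commute)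
  then have "2 * \<bar>x - of_int (round x)\<bar> \<le> sd (x - of_int (round x))"
    by (rule sd_ge_linear)
  also have "\<dots> = sd x" by (rule sd_cong_Ints) simp
  finally show ?thesis .
qed

text \<open>Since \<open>ln 0 = 0\<close>, \<open>phi\<close> is 0 and not infinite at integers.
  Nonnegativity thereby holds without side conditions, and the singular case is carried separately
  as \<open>sd x = 0\<close>.\<close>

definition phi :: "real \<Rightarrow> real" where
  "phi x = - ln (sd x)"

lemma phi_nonneg [simp]: "0 \<le> phi x"
proof (cases "sd x = 0")
  case False
  then have "0 < sd x" using sd_nonneg[of x] by linarith
  then show ?thesis by (simp add: phi_def)
qed (simp add: phi_def)

lemma phi_le_iff: "0 < sd x \<Longrightarrow> phi x \<le> a \<longleftrightarrow> exp (- a) \<le> sd x"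
  using ln_ge_iff[of "sd x" "- a"] by (auto simp: phi_def)

text \<open>A factor 2 in distance costs ln 2 < 1; this is the unit error made at each shadowed
  step.\<close>

lemma phi_le_of_sd_le:
  assumes "0 < sd y" "sd y \<le> 2 * sd x"
  shows "phi x \<le> phi y + 1"
proof -
  have "ln (sd y) \<le> ln (2 * sd x)" using assms by simp
  also have "\<dots> = ln 2 + ln (sd x)" using assms by (intro ln_mult_pos) auto
  finally show ?thesis using ln_2_less_1 by (simp add: phi_def)
qed

text \<open>If the separation \<open>2 ^ j * sd (x - y)\<close> is at most half the distance of
  \<open>2 ^ j * x\<close> from \<open>b\<close>, the triangle inequality compares the distances in
  the direction needed: a close approach of \<open>x\<close> forces one of \<open>y\<close>.\<close>

lemma sd_shadow:
  assumes "2 * 2 ^ j * sd (x - y) \<le> sd (2 ^ j * x - b)"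
  shows "sd (2 ^ j * y - b) \<le> 2 * sd (2 ^ j * x - b)"
proof -
  have "sd (2 ^ j * y - b) \<le> sd (2 ^ j * (y - x)) + sd (2 ^ j * x - b)"
    using sd_add[of "2 ^ j * (y - x)" "2 ^ j * x - b"] by (simp add: algebra_simps)
  also have "sd (2 ^ j * (y - x)) \<le> 2 ^ j * sd (x - y)"
    using sd_mult_power2[of j "y - x"] by (simp add: sd_commute)
  finally show ?thesis using assms sd_nonneg[of "2 ^ j * x - b"] by linarith
qed

text \<open>Each single return is at most exponentially close, a termwise and weaker form of linear
  return sums. It suffices to compare the depth of an approach to \<open>b\<close> with the length
  of the shadowing piece that the approach opens.\<close>

locale slow_return =
  fixes b \<Lambda> :: real
  assumes Lam_nonneg: "0 \<le> \<Lambda>"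
    and sd_return: "\<And>i. i \<ge> 1 \<Longrightarrow> exp (- \<Lambda> * real i) \<le> sd (2 ^ i * b - b)"
begin

lemma sd_return_pos: "i \<ge> 1 \<Longrightarrow> 0 < sd (2 ^ i * b - b)"
  using sd_return[of i] exp_gt_zero[of "- \<Lambda> * real i"] by linarith

lemma phi_return: "i \<ge> 1 \<Longrightarrow> phi (2 ^ i * b - b) \<le> \<Lambda> * real i"
  using sd_return[of i] sd_return_pos[of i] by (simp add: phi_le_iff)

text \<open>\<open>t\<close> is the escape time from the orbit of \<open>b\<close>: the first
  \<open>j\<close> at which \<open>2 ^ j * x\<close> is no longer far from \<open>b\<close> compared
  with \<open>2 ^ j * sd (x - b)\<close>. At that moment \<open>2 ^ t * b\<close> itself is within
  \<open>3 * 2 ^ t * sd (x - b)\<close> of \<open>b\<close>, so slow return makes \<open>t\<close>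
  at least proportional to the depth \<open>phi (x - b)\<close>. The clause for
  \<open>t \<ge> 2\<close> comes from time \<open>t - 1\<close>, which is still far.\<close>

lemma segment:
  assumes pos: "0 < sd (x - b)"
  obtains t where "t \<ge> 1" "phi (x - b) \<le> (\<Lambda> + 2) * real t"
    "\<forall>j\<in>{1..<t}. 0 < sd (2 ^ j * x - b) \<and> phi (2 ^ j * x - b) \<le> phi (2 ^ j * b - b) + 1"
    "t \<ge> 2 \<longrightarrow> 2 ^ t * sd (x - b) \<le> 1"
proof -
  define \<delta> where "\<delta> = sd (x - b)"
  define P where "P = (\<lambda>j::nat. j \<ge> 1 \<and> sd (2 ^ j * x - b) < 2 * 2 ^ j * \<delta>)"
  \<comment> \<open>Such a time exists: once \<open>2 ^ n * \<delta> > 1\<close>, the threshold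
    exceeds 1, the largest value of \<open>sd\<close>.\<close>
  obtain n :: nat where n: "1 / \<delta> < 2 ^ n" using real_arch_pow[of 2 "1 / \<delta>"] by auto
  have "1 < 2 ^ n * \<delta>" using n pos by (simp add: \<delta>_def field_simps)
  then have "sd (2 ^ Suc n * x - b) < 2 * 2 ^ Suc n * \<delta>"
    using sd_le_1[of "2 ^ Suc n * x - b"] by (simp del: sd_le_1)
  then have "P (Suc n)" by (simp add: P_def)
  then have P: "P (LEAST j. P j)" by (rule LeastI)
  have nP: "\<not> P j" if "j < (LEAST j. P j)" for j using that by (rule not_less_Least)
  define t where "t = (LEAST j. P j)"
  have t1: "t \<ge> 1" and t2: "sd (2 ^ t * x - b) < 2 * 2 ^ t * \<delta>" using P by (auto simp: P_def t_def)
  have large: "2 * 2 ^ j * \<delta> \<le> sd (2 ^ j * x - b)" if "1 \<le> j" "j < t" for j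
    using nP[of j] that by (auto simp: P_def t_def)
  show ?thesis
  proof
    show "t \<ge> 1" by (fact t1)
    have "sd (2 ^ t * b - b) \<le> sd (2 ^ t * (b - x)) + sd (2 ^ t * x - b)"
      using sd_add[of "2 ^ t * (b - x)" "2 ^ t * x - b"] by (simp add: algebra_simps)
    also have "sd (2 ^ t * (b - x)) \<le> 2 ^ t * \<delta>"
      using sd_mult_power2[of t "b - x"] by (simp add: sd_commute \<delta>_def)
    finally have "exp (- \<Lambda> * real t) \<le> 3 * 2 ^ t * \<delta>"
      using sd_return[OF t1] t2 by simp
    then have "- \<Lambda> * real t \<le> ln (3 * 2 ^ t * \<delta>)"
      using pos by (subst ln_ge_iff) (auto simp: \<delta>_def)
    also have "\<dots> = ln 3 + real t * ln 2 + ln \<delta>"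
      using pos by (simp add: \<delta>_def ln_mult_pos ln_realpow)
    finally have "phi (x - b) \<le> \<Lambda> * real t + real t * ln 2 + ln 3" by (simp add: \<delta>_def phi_def)
    \<comment> \<open>The bounds ln 3 <= 1.3 and ln 2 <= 0.7 give ln 3 + t ln 2 <= 2 t for t >= 1,
      whence the constant \<open>\<Lambda> + 2\<close>.\<close>
    moreover have "ln (3::real) \<le> 1 + 3 / 10"
    proof -
      have "3 \<le> exp (1 + 3/10 :: real)" using exp_lower_Taylor_quadratic[of "1 + 3/10 :: real"]
        by (simp add: power2_eq_square)
      then show ?thesis by (metis exp_gt_zero ln_exp ln_le_cancel_iff zero_less_numeral)
    qed
    moreover have "ln (2::real) \<le> 7 / 10"
      using ln2_le_25_over_36 by linarith
    moreover from this have "real t * ln 2 \<le> real t * (7 / 10)"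
      by (intro mult_left_mono) auto
    ultimately show "phi (x - b) \<le> (\<Lambda> + 2) * real t"
      using t1 unfolding distrib_right by linarith
    show "\<forall>j\<in>{1..<t}. 0 < sd (2 ^ j * x - b) \<and> phi (2 ^ j * x - b) \<le> phi (2 ^ j * b - b) + 1"
    proof (intro ballI conjI)
      fix j assume "j \<in> {1..<t}"
      then have j: "1 \<le> j" "j < t" by auto
      have "0 < 2 * 2 ^ j * \<delta>" using pos by (simp add: \<delta>_def)
      then show "0 < sd (2 ^ j * x - b)" using large[OF j] by linarith
      show "phi (2 ^ j * x - b) \<le> phi (2 ^ j * b - b) + 1"
        using large[OF j] sd_return_pos[OF j(1)]
        by (intro phi_le_of_sd_le sd_shadow) (auto simp: \<delta>_def)
    qed
    show "t \<ge> 2 \<longrightarrow> 2 ^ t * sd (x - b) \<le> 1"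
    proof
      assume that: "t \<ge> 2"
      have "2 * 2 ^ (t - 1) * \<delta> \<le> 1"
        using large[of "t - 1"] that sd_le_1[of "2 ^ (t - 1) * x - b"] by linarith
      moreover have "(2::real) * 2 ^ (t - 1) = 2 ^ t" using t1 by (metis One_nat_def Suc_pred less_eq_Suc_le power_Suc)
      ultimately show "2 ^ t * sd (x - b) \<le> 1" by (simp add: \<delta>_def)
    qed
  qed
qed

end

section \<open>Return sums and periodic orbits\<close>

definition ret_sum :: "real \<Rightarrow> nat \<Rightarrow> real" where
  "ret_sum b n = (\<Sum>k=1..n. phi (2 ^ k * b - b))"

lemma ret_sum_0 [simp]: "ret_sum b 0 = 0"
  by (simp add: ret_sum_def)

lemma ret_sum_Suc: "ret_sum b (Suc n) = ret_sum b n + phi (2 ^ Suc n * b - b)"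
  by (simp add: ret_sum_def)

lemma ret_sum_mono: "m \<le> n \<Longrightarrow> ret_sum b m \<le> ret_sum b n"
  unfolding ret_sum_def by (intro sum_mono2) (auto intro: phi_nonneg)

lemma ret_sum_nonneg: "0 \<le> ret_sum b n"
  using ret_sum_mono[of 0 n b] by simp

lemma phi_le_ret_sum: "1 \<le> k \<Longrightarrow> k \<le> n \<Longrightarrow> phi (2 ^ k * b - b) \<le> ret_sum b n"
  unfolding ret_sum_def by (rule member_le_sum[where f = "\<lambda>k. phi (2 ^ k * b - b)"]) (auto intro: phi_nonneg)

lemma ret_sum_alt: "n \<ge> 1 \<Longrightarrow> ret_sum b (n - 1) = (\<Sum>j=1..<n. phi (2 ^ j * b - b))"
  unfolding ret_sum_def by (intro sum.cong) auto

text \<open>The positivity clause excludes periodic \<open>b\<close>, for which \<open>phi\<close>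
  is 0 at the exact returns, so that the sums alone would look linearly bounded.\<close>

definition controlled :: "real \<Rightarrow> real \<Rightarrow> bool" where
  "controlled b \<Lambda> \<longleftrightarrow> (\<forall>k\<ge>1. 0 < sd (2 ^ k * b - b)) \<and> (\<forall>n. ret_sum b n \<le> \<Lambda> * real n)"

lemma controlled_slow_return:
  assumes "controlled b \<Lambda>"
  shows "slow_return b \<Lambda>"
proof
  show "0 \<le> \<Lambda>" using assms ret_sum_nonneg[of b 1] unfolding controlled_def
    by (metis mult.right_neutral of_nat_1 order_trans)
  fix i :: nat assume i: "i \<ge> 1"
  have "phi (2 ^ i * b - b) \<le> \<Lambda> * real i"
    using phi_le_ret_sum[of i i b] assms i by (auto simp: controlled_def intro: order_trans)
  then show "exp (- \<Lambda> * real i) \<le> sd (2 ^ i * b - b)"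
    using assms i by (simp add: controlled_def flip: phi_le_iff)
qed

section \<open>Truncated Birkhoff sums along arbitrary orbits\<close>

definition tphi :: "real \<Rightarrow> real \<Rightarrow> real" where
  "tphi M x = (if sd x = 0 then M else min M (phi x))"

lemma tphi_le: "tphi M x \<le> M"
  by (simp add: tphi_def)

lemma tphi_nonneg: "0 \<le> M \<Longrightarrow> 0 \<le> tphi M x"
  using phi_nonneg[of x] by (simp add: tphi_def)

lemma tphi_le_phi: "sd x \<noteq> 0 \<Longrightarrow> tphi M x \<le> phi x"
  by (simp add: tphi_def)

text \<open>Induction on \<open>n\<close> strips off one escape segment of length \<open>t\<close>:
  its first term costs at most \<open>(\<Lambda> + 2) * t\<close>, its shadowing terms
  \<open>(\<Lambda> + 1) * t\<close>. Only a segment cut off by the end of the orbit, or one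
  starting at \<open>b\<close> itself, has its first term paid by the truncation level. This happens
  once, so \<open>M\<close> enters additively and not per unit of time.\<close>

lemma truncated_birkhoff_bound:
  assumes ctl: "controlled b \<Lambda>" and M: "0 \<le> M"
  shows "(\<Sum>j<n. tphi M (2 ^ j * x - b)) \<le> (2 * \<Lambda> + 3) * real n + M"
proof (induction n arbitrary: x rule: less_induct)
  case (less n)
  interpret slow_return b \<Lambda> by (rule controlled_slow_return[OF ctl])
  have S: "ret_sum b m \<le> \<Lambda> * real m" for m using ctl by (simp add: controlled_def)
  have split0: "(\<Sum>j<t. tphi M (2 ^ j * x - b)) = tphi M (x - b) + (\<Sum>j=1..<t. tphi M (2 ^ j * x - b))"
    if "t \<ge> 1" for t
    using that by (simp add: sum.atLeast_Suc_lessThan lessThan_atLeast0)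
  have shadow: "(\<Sum>j=1..<t. tphi M (2 ^ j * x - b)) \<le> (\<Lambda> + 1) * real t"
    if t: "t \<ge> 1" and le: "\<And>j. 1 \<le> j \<Longrightarrow> j < t \<Longrightarrow>
      tphi M (2 ^ j * x - b) \<le> phi (2 ^ j * b - b) + 1" for t
  proof -
    have "(\<Sum>j=1..<t. tphi M (2 ^ j * x - b)) \<le> (\<Sum>j=1..<t. phi (2 ^ j * b - b) + 1)"
      using le by (intro sum_mono) auto
    also have "\<dots> = ret_sum b (t - 1) + real (t - 1)"
      using ret_sum_alt[OF t, of b] by (simp add: sum.distrib)
    also have "\<dots> \<le> \<Lambda> * real (t - 1) + real (t - 1)" using S by simp
    also have "\<dots> = (\<Lambda> + 1) * real (t - 1)" by (simp add: algebra_simps)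
    also have "\<dots> \<le> (\<Lambda> + 1) * real t" using Lam_nonneg by (intro mult_left_mono) auto
    finally show ?thesis .
  qed
  have mono: "(\<Lambda> + 1) * real n \<le> (2 * \<Lambda> + 3) * real n"
    using Lam_nonneg by (intro mult_right_mono) auto
  show ?case
  proof (cases "n = 0")
    case True
    then show ?thesis using M by simp
  next
    case False
    then have n: "n \<ge> 1" by simp
    show ?thesis
    proof (cases "sd (x - b) = 0")
      case True
      \<comment> \<open>On the circle the point is \<open>b\<close>, so it never escapes: the rest
        of its orbit is that of \<open>b\<close>.\<close>
      have eq: "sd (2 ^ j * x - b) = sd (2 ^ j * b - b)" for j
      proof -
        have "2 ^ j * (x - b) \<in> \<int>" using True by (intro Ints_mult Ints_power) (auto simp: sd_eq_0_iff)
        then show ?thesis by (intro sd_cong_Ints) (simp add: algebra_simps)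
      qed
      have "(\<Sum>j=1..<n. tphi M (2 ^ j * x - b)) \<le> (\<Lambda> + 1) * real n"
      proof (rule shadow[OF n])
        fix j :: nat assume "1 \<le> j"
        then have "sd (2 ^ j * x - b) \<noteq> 0" using sd_return_pos[of j] by (simp add: eq)
        then show "tphi M (2 ^ j * x - b) \<le> phi (2 ^ j * b - b) + 1"
          using tphi_le_phi[of "2 ^ j * x - b" M] unfolding phi_def eq[of j] by linarith
      qed
      then show ?thesis using split0[OF n] tphi_le[of M "x - b"] mono by linarith
    next
      case False
      then have pos: "0 < sd (x - b)" using sd_nonneg[of "x - b"] by linarith
      obtain t where t: "t \<ge> 1" "phi (x - b) \<le> (\<Lambda> + 2) * real t"
        "\<forall>j\<in>{1..<t}. 0 < sd (2 ^ j * x - b) \<and> phi (2 ^ j * x - b) \<le> phi (2 ^ j * b - b) + 1"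
        using segment[OF pos] by metis
      have le: "tphi M (2 ^ j * x - b) \<le> phi (2 ^ j * b - b) + 1" if "1 \<le> j" "j < t" for j
        using bspec[OF t(3), of j] that tphi_le_phi[of "2 ^ j * x - b" M] by auto
      show ?thesis
      proof (cases "t < n")
        case True
        have "(\<Sum>j<n. tphi M (2 ^ j * x - b)) =
          (\<Sum>j<t. tphi M (2 ^ j * x - b)) + (\<Sum>j<n - t. tphi M (2 ^ (j + t) * x - b))"
          using sum.atLeastLessThan_concat[of 0 t n "\<lambda>j. tphi M (2 ^ j * x - b)"] True
            sum.shift_bounds_nat_ivl[of "\<lambda>j. tphi M (2 ^ j * x - b)" 0 t "n - t"]
          by (simp add: lessThan_atLeast0)
        also have "(\<Sum>j<n - t. tphi M (2 ^ (j + t) * x - b)) \<le> (2 * \<Lambda> + 3) * real (n - t) + M"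
          using less.IH[of "n - t" "2 ^ t * x"] True t(1) by (simp add: power_add mult.assoc)
        also have "(\<Sum>j<t. tphi M (2 ^ j * x - b)) \<le> (\<Lambda> + 2) * real t + (\<Lambda> + 1) * real t"
          using split0[OF t(1)] shadow[OF t(1) le] tphi_le_phi[OF False, of M] t(2) by linarith
        also have "(\<Lambda> + 2) * real t + (\<Lambda> + 1) * real t + ((2 * \<Lambda> + 3) * real (n - t) + M)
            = (2 * \<Lambda> + 3) * real n + M"
          using True by (simp add: of_nat_diff algebra_simps)
        finally show ?thesis by simp
      next
        case False
        then have "(\<Sum>j=1..<n. tphi M (2 ^ j * x - b)) \<le> (\<Lambda> + 1) * real n"
          by (intro shadow[OF n] le) auto
        then show ?thesis using split0[OF n] tphi_le[of M "x - b"] mono by linarith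
      qed
    qed
  qed
qed

section \<open>From bounded periodic averages to linear return sums\<close>

locale periodic_bound =
  fixes b A :: real
  assumes A_nonneg: "0 \<le> A"
    and periodic_pos: "\<And>n p j. n \<ge> 1 \<Longrightarrow> 2 ^ n * p - p \<in> \<int> \<Longrightarrow> j < n \<Longrightarrow> 0 < sd (2 ^ j * p - b)"
    and periodic_sum: "\<And>n p. n \<ge> 1 \<Longrightarrow> 2 ^ n * p - p \<in> \<int> \<Longrightarrow> (\<Sum>j<n. phi (2 ^ j * p - b)) \<le> A * real n"
begin

text \<open>\<open>p\<close> is a nearest multiple of \<open>1 / (2 ^ n - 1)\<close>. The error is
  kept as a distance to the nearest integer because two values of it are used: the trivial 1/2 for
  arbitrary \<open>x\<close>, and the true return distance when \<open>b\<close> comes back close to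
  itself.\<close>

lemma closing:
  assumes n: "n \<ge> (1::nat)"
  obtains p :: real where "2 ^ n * p - p \<in> \<int>" "2 ^ n * \<bar>p - x\<bar> \<le> 2 * \<bar>(2 ^ n - 1) * x - of_int (round ((2 ^ n - 1) * x))\<bar>"
proof -
  define t where "t = real_of_int (round ((2 ^ n - 1) * x))"
  have "(2::real) ^ 1 \<le> 2 ^ n" using n by (intro power_increasing) auto
  then have pos: "(2::real) ^ n \<le> 2 * (2 ^ n - 1)" "0 < (2::real) ^ n - 1" by auto
  show ?thesis
  proof
    let ?p = "t / (2 ^ n - 1)"
    have "2 ^ n * ?p - ?p = (2 ^ n - 1) * ?p" by (simp only: left_diff_distrib mult_1)
    also have "\<dots> = t" using pos(2) by simp
    finally show "2 ^ n * ?p - ?p \<in> \<int>" by (simp add: t_def)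
    have "2 ^ n * \<bar>?p - x\<bar> \<le> 2 * (2 ^ n - 1) * \<bar>?p - x\<bar>" using pos by (intro mult_right_mono) auto
    also have "(2 ^ n - 1) * \<bar>?p - x\<bar> = \<bar>(2 ^ n - 1) * (?p - x)\<bar>" using pos(2) by (simp only: abs_mult abs_of_pos)
    then have "2 * (2 ^ n - 1) * \<bar>?p - x\<bar> = 2 * \<bar>(2 ^ n - 1) * (?p - x)\<bar>"
      unfolding mult.assoc by (rule arg_cong)
    also have "(2 ^ n - 1) * (?p - x) = t - (2 ^ n - 1) * x" using pos(2) by (simp add: right_diff_distrib)
    finally show "2 ^ n * \<bar>?p - x\<bar> \<le> 2 * \<bar>(2 ^ n - 1) * x - of_int (round ((2 ^ n - 1) * x))\<bar>"
      by (simp add: t_def abs_minus_commute)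
  qed
qed

text \<open>A close return of \<open>b\<close> at time \<open>k\<close> closes up to a point of
  period \<open>k\<close> whose distance from \<open>b\<close> is at most twice the return distance;
  its depth is one term of a periodic sum bounded by \<open>A * k\<close>.\<close>

lemma slow_return: "slow_return b (A + 1)"
proof
  show "0 \<le> A + 1" using A_nonneg by simp
  fix k :: nat assume k: "k \<ge> 1"
  obtain p where p: "2 ^ k * p - p \<in> \<int>"
    "2 ^ k * \<bar>p - b\<bar> \<le> 2 * \<bar>(2 ^ k - 1) * b - of_int (round ((2 ^ k - 1) * b))\<bar>"
    using closing[OF k] by blast
  have "2 ^ k * \<bar>p - b\<bar> \<le> sd (2 ^ k * b - b)"
    using p(2) sd_round[of "(2 ^ k - 1) * b"] by (simp add: left_diff_distrib)
  moreover have "(2::real) ^ 1 \<le> 2 ^ k" using k by (intro power_increasing) auto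
  then have "2 * \<bar>p - b\<bar> \<le> 2 ^ k * \<bar>p - b\<bar>" by (intro mult_right_mono) auto
  ultimately have "2 * \<bar>p - b\<bar> \<le> sd (2 ^ k * b - b)" by linarith
  moreover have "sd (p - b) \<le> 4 * \<bar>p - b\<bar>"
    using sd_le_pi[of "p - b"] pi_less_4 mult_right_mono[of pi 4 "\<bar>p - b\<bar>"] by linarith
  ultimately have le: "sd (p - b) \<le> 2 * sd (2 ^ k * b - b)" by linarith
  have pos: "0 < sd (p - b)" using periodic_pos[OF k p(1), of 0] k by simp
  have "phi (p - b) \<le> (\<Sum>j<k. phi (2 ^ j * p - b))"
    using member_le_sum[of 0 "{..<k}" "\<lambda>j. phi (2 ^ j * p - b)"] k phi_nonneg by auto
  also have "\<dots> \<le> A * real k" by (rule periodic_sum[OF k p(1)])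
  finally have "phi (2 ^ k * b - b) \<le> A * real k + 1"
    using phi_le_of_sd_le[OF pos le] by linarith
  also have "\<dots> \<le> (A + 1) * real k" using k by (simp add: algebra_simps)
  finally show "exp (- (A + 1) * real k) \<le> sd (2 ^ k * b - b)"
    using pos le phi_le_iff[of "2 ^ k * b - b" "(A + 1) * real k"]
    unfolding mult_minus_left by linarith
qed

text \<open>Some point of period \<open>n\<close> stays within \<open>4 * 2 ^ j / 2 ^ n\<close> of
  \<open>2 ^ j * x\<close> at time \<open>j\<close>, the 4 being a bound for pi, and
  \<open>far\<close> asks for twice that. The index 0 is left out since \<open>x\<close> may be
  \<open>b\<close> itself.\<close>

lemma shadow_sum:
  assumes n: "n \<ge> 1" and far: "\<And>j. 1 \<le> j \<Longrightarrow> j < m \<Longrightarrow> 8 * 2 ^ j \<le> 2 ^ n * sd (2 ^ j * x - b)" and "m \<le> n"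
  shows "(\<Sum>j=1..<m. phi (2 ^ j * x - b)) \<le> (A + 1) * real n"
proof -
  obtain p where p: "2 ^ n * p - p \<in> \<int>"
    "2 ^ n * \<bar>p - x\<bar> \<le> 2 * \<bar>(2 ^ n - 1) * x - of_int (round ((2 ^ n - 1) * x))\<bar>"
    using closing[OF n] by blast
  have "2 ^ n * \<bar>p - x\<bar> \<le> 1"
    using p(2) of_int_round_abs_le[of "(2 ^ n - 1) * x"] by (simp add: abs_minus_commute)
  moreover have "sd (x - p) \<le> 4 * \<bar>p - x\<bar>"
    using sd_le_pi[of "p - x"] pi_less_4 mult_right_mono[of pi 4 "\<bar>p - x\<bar>"] by (simp add: sd_commute)
  ultimately have xp: "2 ^ n * sd (x - p) \<le> 4"
  proof -
    assume "sd (x - p) \<le> 4 * \<bar>p - x\<bar>"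
    then have "2 ^ n * sd (x - p) \<le> 2 ^ n * (4 * \<bar>p - x\<bar>)" by (rule mult_left_mono) simp
    also have "\<dots> = 4 * (2 ^ n * \<bar>p - x\<bar>)" by (rule mult.left_commute)
    finally show ?thesis using \<open>2 ^ n * \<bar>p - x\<bar> \<le> 1\<close> by linarith
  qed
  have le: "phi (2 ^ j * x - b) \<le> phi (2 ^ j * p - b) + 1" if j: "1 \<le> j" "j < m" for j
  proof (rule phi_le_of_sd_le)
    show "0 < sd (2 ^ j * p - b)" using periodic_pos[OF n p(1), of j] j assms by auto
    have "2 ^ n * (2 * 2 ^ j * sd (x - p)) = 2 * 2 ^ j * (2 ^ n * sd (x - p))" by simp
    also have "\<dots> \<le> 2 * 2 ^ j * 4" using xp by (intro mult_left_mono) auto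
    also have "\<dots> \<le> 2 ^ n * sd (2 ^ j * x - b)" using far[OF j] by simp
    finally show "sd (2 ^ j * p - b) \<le> 2 * sd (2 ^ j * x - b)" by (intro sd_shadow) auto
  qed
  have "(\<Sum>j=1..<m. phi (2 ^ j * x - b)) \<le> (\<Sum>j=1..<m. phi (2 ^ j * p - b) + 1)"
    using le by (intro sum_mono) auto
  also have "\<dots> \<le> (\<Sum>j<n. phi (2 ^ j * p - b) + 1)"
    using assms phi_nonneg by (intro sum_mono2) (auto intro!: add_nonneg_nonneg)
  also have "\<dots> = (\<Sum>j<n. phi (2 ^ j * p - b)) + real n" by (simp add: sum.distrib)
  also have "\<dots> \<le> A * real n + real n" using periodic_sum[OF n p(1)] by simp
  finally show ?thesis by (simp add: algebra_simps)
qed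

text \<open>All constants depend on \<open>A\<close> only: the contribution of the closest approach to \<open>b\<close>, estimated
  by \<open>M\<close>, is charged once, since after an exceptionally close approach the orbit
  follows that of \<open>b\<close>, whose returns are slow.\<close>
lemma near_orbit_sum:
  defines "C \<equiv> (2 * A + 5) * (2 * A + 7)"
  assumes "n \<ge> 1" "2 ^ n * sd (x - b) \<le> 8" "0 \<le> M"
    and "\<And>j. 1 \<le> j \<Longrightarrow> j < n \<Longrightarrow> 0 < sd (2 ^ j * x - b) \<and> phi (2 ^ j * x - b) \<le> M"
  shows "(\<Sum>j=1..<n. phi (2 ^ j * x - b)) \<le> C * real n + M"
  using assms(2-)
proof (induction n arbitrary: x M rule: less_induct)
  case (less n)
  interpret slow_return b "A + 1" by (rule slow_return)
  \<comment> \<open>First failure of \<open>far\<close>: at time \<open>k\<close> the orbit is again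
    within \<open>8 / 2 ^ m\<close> of \<open>b\<close>, with \<open>m = n - k\<close> steps left,
    so \<open>2 ^ k * x\<close> satisfies the closeness hypothesis for the shorter length.\<close>
  define P where "P = (\<lambda>j. 1 \<le> j \<and> j < n \<and> 2 ^ n * sd (2 ^ j * x - b) < 8 * 2 ^ j)"
  have "(A + 1) * real n \<le> C * real n"
    unfolding C_def using A_nonneg by (intro mult_right_mono) (auto simp: algebra_simps)
  show ?case
  proof (cases "\<exists>j. P j")
    case False
    then have "(\<Sum>j=1..<n. phi (2 ^ j * x - b)) \<le> (A + 1) * real n"
      by (intro shadow_sum less.prems) (auto simp: P_def not_less)
    also note \<open>\<dots> \<le> C * real n\<close>
    finally show ?thesis using less.prems(3) by linarith
  next
    case True
    define k where "k = (LEAST j. P j)"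
    have Pk: "P k" unfolding k_def by (rule LeastI_ex[OF True])
    have nP: "\<not> P j" if "j < k" for j using that unfolding k_def by (rule not_less_Least)
    from Pk have k: "1 \<le> k" "k < n" "2 ^ n * sd (2 ^ k * x - b) < 8 * 2 ^ k" by (auto simp: P_def)
    define m where "m = n - k"
    have n: "n = m + k" and m: "m \<ge> 1" "m < n" using k by (auto simp: m_def)
    define y where "y = 2 ^ k * x"
    have y: "2 ^ j * y = 2 ^ (j + k) * x" for j by (simp add: y_def power_add)
    have y0: "2 ^ m * sd (y - b) \<le> 8" using k(3) by (simp add: n power_add y_def)
    have first: "(\<Sum>j=1..<k. phi (2 ^ j * x - b)) \<le> (A + 1) * real n"
      using nP k(2) by (intro shadow_sum less.prems(1)) (auto simp: P_def not_less)
    have split: "(\<Sum>j=1..<n. phi (2 ^ j * x - b)) =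
        (\<Sum>j=1..<k. phi (2 ^ j * x - b)) + (phi (y - b) + (\<Sum>j=1..<m. phi (2 ^ j * y - b)))"
    proof -
      have "(\<Sum>j=k..<n. phi (2 ^ j * x - b)) = (\<Sum>j=0..<m. phi (2 ^ j * y - b))"
        using sum.shift_bounds_nat_ivl[of "\<lambda>j. phi (2 ^ j * x - b)" 0 k m] by (simp add: y n)
      also have "\<dots> = phi (y - b) + (\<Sum>j=1..<m. phi (2 ^ j * y - b))"
        using m by (simp add: sum.atLeast_Suc_lessThan)
      finally show ?thesis
        using sum.atLeastLessThan_concat[of 1 k n "\<lambda>j. phi (2 ^ j * x - b)"] k by simp
    qed
    \<comment> \<open>Both \<open>2 ^ k * x\<close> and, by shadowing, \<open>2 ^ k * b\<close> lie
      within a constant times \<open>1 / 2 ^ m\<close> of \<open>b\<close>; slow return at time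
      \<open>k\<close> then bounds the remaining length \<open>m\<close> by a multiple of
      \<open>k\<close>.\<close>
    have mk: "real m \<le> (2 * A + 6) * real k"
    proof -
      have "2 ^ m * sd (2 ^ k * b - b) \<le> 2 ^ m * sd (2 ^ k * (b - x)) + 2 ^ m * sd (2 ^ k * x - b)"
        using sd_add[of "2 ^ k * (b - x)" "2 ^ k * x - b"]
        by (simp add: right_diff_distrib flip: distrib_left)
      also have "2 ^ m * sd (2 ^ k * (b - x)) \<le> 2 ^ m * (2 ^ k * sd (x - b))"
        using sd_mult_power2[of k "b - x"] by (simp add: sd_commute)
      also have "\<dots> \<le> 8" using less.prems(2) by (simp add: n power_add mult.assoc)
      also have "2 ^ m * sd (2 ^ k * x - b) \<le> 8" using y0 by (simp add: y_def)
      finally have le16: "2 ^ m * sd (2 ^ k * b - b) \<le> 2 ^ 4" by simp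
      have "real m * ln 2 + ln (sd (2 ^ k * b - b)) = ln (2 ^ m * sd (2 ^ k * b - b))"
        using sd_return_pos[OF k(1)] by (simp add: ln_mult_pos ln_realpow)
      also have "\<dots> \<le> ln (2 ^ 4)" using le16 sd_return_pos[OF k(1)] by (subst ln_le_cancel_iff) auto
      also have "\<dots> = 4 * ln (2::real)" by (subst ln_realpow) auto
      finally have "real m * ln 2 \<le> 4 * ln 2 + (A + 1) * real k" using phi_return[OF k(1)] unfolding phi_def by linarith
      then have "(real m - 4) * ln 2 \<le> (A + 1) * real k" by (simp add: algebra_simps)
      moreover have "(real m - 4) * (1 / 2) \<le> (real m - 4) * ln 2" if "real m \<ge> 4"
        using that ln2_ge_two_thirds by (intro mult_left_mono) auto
      moreover have "0 \<le> (A + 1) * real k" using A_nonneg by simp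
      ultimately have "real m \<le> 4 + 2 * ((A + 1) * real k)" by (cases "real m \<ge> 4") auto
      then show ?thesis using k(1) by (simp add: algebra_simps)
    qed
    \<comment> \<open>This fixes \<open>C\<close>: the costs at this level are at most
      \<open>(2 * A + 5) * n\<close> with \<open>n \<le> (2 * A + 7) * k\<close>, and passing from
      \<open>n\<close> to \<open>m\<close> frees exactly \<open>C * k\<close>.\<close>
    have absorb: "(A + 1) * real n + (A + 4) * real m + C * real m \<le> C * real n"
    proof -
      have "(A + 1) * real n + (A + 4) * real m \<le> (2 * A + 5) * (real m + real k)"
        using A_nonneg by (simp add: n algebra_simps)
      also have "\<dots> \<le> (2 * A + 5) * ((2 * A + 6) * real k + real k)"
        using A_nonneg mk by (intro mult_left_mono add_right_mono) auto
      also have "\<dots> = C * real k" by (simp add: C_def algebra_simps)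
      finally show ?thesis by (simp add: n algebra_simps)
    qed
    have prems: "0 < sd (2 ^ j * y - b)" "phi (2 ^ j * y - b) \<le> M" if "j < m" for j
      using less.prems(4)[of "j + k"] that k(1) by (auto simp: y n)
    have y_prems: "0 < sd (y - b)" "phi (y - b) \<le> M" using prems[of 0] m by auto
    show ?thesis
    proof (cases "phi (y - b) \<le> (A + 4) * real m")
      case True
      have "(\<Sum>j=1..<m. phi (2 ^ j * y - b)) \<le> C * real m + M"
        using m y0 less.prems(3) prems by (intro less.IH) auto
      then show ?thesis using True first split absorb by linarith
    next
      case False
      then have close: "sd (y - b) < exp (- (A + 4) * real m)"
        using y_prems(1) phi_le_iff[of "y - b" "(A + 4) * real m"] unfolding mult_minus_left by linarith
      \<comment> \<open>The threshold \<open>A + 4\<close> leaves room for the growth of the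
        separation, \<open>2 ^ (j + 1) \<le> exp (j + 1)\<close>, below the return bound
        \<open>exp (- (A + 1) * j)\<close> for all \<open>j < m\<close>.\<close>
      have bd: "phi (2 ^ j * y - b) \<le> (A + 4) * real m" if j: "1 \<le> j" "j < m" for j
      proof -
        have "2 * 2 ^ j * sd (y - b) \<le> sd (2 ^ j * b - b)"
        proof -
          have "(2::real) ^ j * 2 \<le> exp (real (Suc j))"
          proof -
            have "(2::real) ^ Suc j \<le> exp 1 ^ Suc j" using exp_ge_add_one_self[of 1] by (intro power_mono) auto
            then show ?thesis by (simp add: exp_add exp_of_nat_mult[symmetric] mult.commute)
          qed
          then have "2 * 2 ^ j * sd (y - b) \<le> exp (real (Suc j)) * exp (- (A + 4) * real m)"
            using close by (intro mult_mono) auto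
          also have "\<dots> = exp (real (Suc j) - (A + 4) * real m)"
            unfolding exp_add[symmetric] by (rule arg_cong) (simp only: mult_minus_left, simp)
          also have "\<dots> \<le> exp (- (A + 1) * real j)"
          proof -
            have "(A + 4) * real (Suc j) \<le> (A + 4) * real m" using A_nonneg j by (intro mult_left_mono) auto
            moreover have "(A + 4) * real (Suc j) = (A + 1) * real j + 3 * real j + A + 4"
              by (simp add: algebra_simps)
            ultimately have "real (Suc j) - (A + 4) * real m \<le> - (A + 1) * real j"
              using A_nonneg unfolding mult_minus_left by linarith
            then show ?thesis by (subst exp_le_cancel_iff)
          qed
          also have "\<dots> \<le> sd (2 ^ j * b - b)" using sd_return[OF j(1)] .
          finally show ?thesis .
        qed
        then have "2 * 2 ^ j * sd (b - y) \<le> sd (2 ^ j * b - b)" by (simp add: sd_commute)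
        moreover have "sd (2 ^ j * b - b) \<le> sd (2 ^ j * (b - y)) + sd (2 ^ j * y - b)"
          using sd_add[of "2 ^ j * (b - y)" "2 ^ j * y - b"] by (simp add: right_diff_distrib)
        ultimately have far: "sd (2 ^ j * b - b) \<le> 2 * sd (2 ^ j * y - b)"
          using sd_mult_power2[of j "b - y"] by linarith
        have "phi (2 ^ j * y - b) \<le> phi (2 ^ j * b - b) + 1"
          by (rule phi_le_of_sd_le[OF sd_return_pos[OF j(1)] far])
        also have "\<dots> \<le> (A + 1) * real j + 1" using phi_return[OF j(1)] by simp
        also have "\<dots> \<le> (A + 1) * real m + real m" using A_nonneg j by (intro add_mono mult_left_mono) auto
        also have "\<dots> \<le> (A + 4) * real m" by (simp add: algebra_simps)
        finally show ?thesis .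
      qed
      have "(\<Sum>j=1..<m. phi (2 ^ j * y - b)) \<le> C * real m + (A + 4) * real m"
        using m y0 prems bd A_nonneg by (intro less.IH) auto
      then show ?thesis using y_prems(2) first split absorb by linarith
    qed
  qed
qed

text \<open>The estimate is applied at \<open>x = b\<close>, where the closeness hypothesis is
  trivial; slow return supplies \<open>M = (A + 1) * n\<close>, which is itself linear.\<close>

lemma ex_controlled: "\<exists>\<Lambda>. controlled b \<Lambda>"
proof -
  interpret slow_return b "A + 1" by (rule slow_return)
  define C where "C = (2 * A + 5) * (2 * A + 7)"
  have C: "0 \<le> C" using A_nonneg by (simp add: C_def)
  have "ret_sum b n \<le> (2 * C + A + 1) * real n" for n
  proof (cases "n = 0")
    case False
    have "(\<Sum>j=1..<Suc n. phi (2 ^ j * b - b)) \<le> C * real (Suc n) + (A + 1) * real n"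
      unfolding C_def
    proof (intro near_orbit_sum conjI)
      fix j :: nat assume j: "1 \<le> j" "j < Suc n"
      have "(A + 1) * real j \<le> (A + 1) * real n" using A_nonneg j by (intro mult_left_mono) auto
      then show "phi (2 ^ j * b - b) \<le> (A + 1) * real n" using phi_return[OF j(1)] by linarith
    qed (use A_nonneg sd_return_pos in \<open>auto simp: sd_def\<close>)
    moreover have "C * real (Suc n) \<le> 2 * C * real n"
      using mult_left_mono[OF _ C, of "real (Suc n)" "2 * real n"] False by simp
    ultimately show ?thesis using ret_sum_alt[of "Suc n" b] by (simp add: algebra_simps)
  qed simp
  then show ?thesis using sd_return_pos unfolding controlled_def by blast
qed

end

section \<open>Integrals over invariant measures\<close>

lemma fc_conv_sd:
  "fc c x = (if sd (x - (1/2 - c)) = 0 then - \<infinity> else - ereal (phi (x - (1/2 - c))))"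
proof -
  have "pi * (x - (1/2 - c)) = pi * (x + c) - pi / 2" by (simp add: algebra_simps)
  then have "cos (pi * (x + c)) = - sin (pi * (x - (1/2 - c)))" by (simp add: sin_diff)
  then show ?thesis by (simp add: fc_def sd_def phi_def)
qed

lemma logsin_conv_sd: "logsin x = (if sd x = 0 then - \<infinity> else - ereal (phi x))"
  by (simp add: logsin_def sd_def phi_def)

lemma neg_fc_conv_sd:
  "e2ennreal (- fc c x) = (if sd (x - (1/2 - c)) = 0 then \<infinity> else ennreal (phi (x - (1/2 - c))))"
  by (simp add: fc_conv_sd flip: ennreal_def)

text \<open>A finite lower bound for the liminf bounds the averages only from some \<open>N\<close>
  on; monotone return sums extend it to smaller \<open>n\<close> at the price of the factor
  \<open>N'\<close>. Positivity is recovered because one exact return makes every later partial sum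
  \<open>- \<infinity>\<close>.\<close>

lemma mstar_ne_MInf_iff: "mstar c \<noteq> - \<infinity> \<longleftrightarrow> (\<exists>\<Lambda>. controlled (1/2 - c) \<Lambda>)"
proof -
  define b where "b = 1/2 - c"
  define X where "X = (\<lambda>n::nat. ereal (1 / real n) * (\<Sum>k=1..n. logsin (2 ^ k * b - b)))"
  have m: "mstar c = liminf X" by (simp add: mstar_def b_def X_def Let_def)
  have sum_fin: "(\<Sum>k=1..n. logsin (2 ^ k * b - b)) = - ereal (ret_sum b n)"
    if "\<And>k. 1 \<le> k \<Longrightarrow> k \<le> n \<Longrightarrow> sd (2 ^ k * b - b) \<noteq> 0" for n
  proof -
    have "(\<Sum>k=1..n. logsin (2 ^ k * b - b)) = (\<Sum>k=1..n. ereal (- phi (2 ^ k * b - b)))"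
      using that by (intro sum.cong) (auto simp: logsin_conv_sd)
    also have "\<dots> = - ereal (ret_sum b n)"
      by (subst sum_ereal) (simp add: ret_sum_def sum_negf)
    finally show ?thesis .
  qed
  have sum_inf: "(\<Sum>k=1..n. logsin (2 ^ k * b - b)) = - \<infinity>"
    if "sd (2 ^ k * b - b) = 0" "1 \<le> k" "k \<le> n" for k n
  proof -
    have "(\<Sum>k=1..n. logsin (2 ^ k * b - b)) =
        logsin (2 ^ k * b - b) + (\<Sum>k\<in>{1..n} - {k}. logsin (2 ^ k * b - b))"
      using that by (intro sum.remove) auto
    moreover have "(\<Sum>k\<in>{1..n} - {k}. logsin (2 ^ k * b - b)) \<noteq> \<infinity>"
      by (subst sum_Pinfty) (auto simp: logsin_conv_sd)
    ultimately show ?thesis using that by (simp add: logsin_conv_sd)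
  qed
  show ?thesis
  proof
    assume "mstar c \<noteq> - \<infinity>"
    then have "- \<infinity> < liminf X" by (simp add: m less_le)
    then obtain r where r: "- \<infinity> < ereal r" "ereal r < liminf X" using ereal_dense2 by blast
    then obtain N where N: "\<And>n. n \<ge> N \<Longrightarrow> ereal r < X n"
      using less_LiminfD[OF r(2)] by (auto simp: eventually_sequentially)
    have pos: "sd (2 ^ k * b - b) \<noteq> 0" if "1 \<le> k" for k
    proof
      assume "sd (2 ^ k * b - b) = 0"
      then have "X (max N k) = - \<infinity>" using sum_inf[of k "max N k"] that
        by (auto simp: X_def ereal_mult_eq_MInfty)
      then show False using N[of "max N k"] by simp
    qed
    have le: "ret_sum b n \<le> \<bar>r\<bar> * real n" if "n \<ge> N" "n \<ge> 1" for n
    proof -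
      have "r < 1 / real n * - ret_sum b n"
        using N[OF that(1)] sum_fin[of n] pos by (simp add: X_def)
      then have "ret_sum b n < - r * real n" using that by (simp add: field_simps)
      also have "\<dots> \<le> \<bar>r\<bar> * real n" by (intro mult_right_mono) auto
      finally show ?thesis by simp
    qed
    define N' where "N' = max N 1"
    have "ret_sum b n \<le> (\<bar>r\<bar> * real N') * real n" for n
    proof (cases "n = 0")
      case False
      then have n: "real n \<ge> 1" "real N' \<ge> 1" by (auto simp: N'_def)
      show ?thesis
      proof (cases "n \<ge> N'")
        case True
        have "ret_sum b n \<le> \<bar>r\<bar> * real n" using le[of n] True by (simp add: N'_def)
        also have "\<dots> \<le> \<bar>r\<bar> * (real N' * real n)" using n by (intro mult_left_mono) auto
        finally show ?thesis by simp
      next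
        case False
        have "ret_sum b n \<le> ret_sum b N'" using False by (intro ret_sum_mono) auto
        also have "\<dots> \<le> \<bar>r\<bar> * real N'" by (rule le) (auto simp: N'_def)
        also have "\<dots> \<le> \<bar>r\<bar> * real N' * real n"
          using n mult_left_mono[of 1 "real n" "\<bar>r\<bar> * real N'"] by simp
        finally show ?thesis .
      qed
    qed simp
    then show "\<exists>\<Lambda>. controlled (1/2 - c) \<Lambda>"
      using pos unfolding controlled_def b_def[symmetric] by (metis sd_nonneg less_le)
  next
    assume "\<exists>\<Lambda>. controlled (1/2 - c) \<Lambda>"
    then obtain \<Lambda> where L: "controlled b \<Lambda>" by (auto simp: b_def)
    have "ereal (- \<Lambda>) \<le> X n" if "n \<ge> 1" for n
    proof -
      have "X n = ereal (- (ret_sum b n / real n))"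
        using L by (subst X_def, subst sum_fin) (auto simp: controlled_def less_le)
      moreover have "ret_sum b n / real n \<le> \<Lambda>"
        using L that by (simp add: controlled_def field_simps)
      ultimately show ?thesis by simp
    qed
    then have "ereal (- \<Lambda>) \<le> liminf X"
      by (intro Liminf_bounded) (auto simp: eventually_sequentially)
    then show "mstar c \<noteq> - \<infinity>" by (auto simp: m)
  qed
qed

section \<open>Iterates of the doubling map on real representatives; measurability\<close>

lemma frac_eq_iff: "frac x = frac y \<longleftrightarrow> x - y \<in> \<int>" for x y :: real
proof
  assume "frac x = frac y"
  then have "x - y = of_int (\<lfloor>x\<rfloor> - \<lfloor>y\<rfloor>)" by (simp add: frac_def)
  then show "x - y \<in> \<int>" by (metis Ints_of_int)
next
  assume "x - y \<in> \<int>"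
  then show "frac x = frac y" by (metis frac_add_int_right diff_add_cancel add.commute)
qed

lemma dbl_funpow: "(dbl ^^ n) (frac x) = frac (2 ^ n * x)"
proof (induction n)
  case (Suc n)
  have "frac (2 * frac y) = frac (2 * y)" for y :: real
  proof -
    have "2 * y - 2 * frac y = of_int (2 * \<lfloor>y\<rfloor>)" by (simp add: frac_def)
    then have "2 * y - 2 * frac y \<in> \<int>" by (metis Ints_of_int)
    then show ?thesis by (metis frac_eq_iff)
  qed
  with Suc show ?case by (simp add: dbl_def mult.assoc)
qed simp

lemma sd_dbl_funpow: "sd ((dbl ^^ n) x - b) = sd (2 ^ n * x - b)"
proof (induction n arbitrary: x)
  case (Suc n)
  have "sd ((dbl ^^ Suc n) x - b) = sd (2 ^ n * dbl x - b)"
    using Suc[of "dbl x"] by (simp add: funpow_swap1)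
  also have "\<dots> = sd (2 ^ Suc n * x - b)"
  proof (rule sd_cong_Ints)
    have "(2 ^ n * dbl x - b) - (2 ^ Suc n * x - b) = - (of_int (2 ^ n * \<lfloor>2 * x\<rfloor>))"
      by (simp add: dbl_def frac_def algebra_simps)
    then show "(2 ^ n * dbl x - b) - (2 ^ Suc n * x - b) \<in> \<int>" by simp
  qed
  finally show ?case .
qed simp

lemma sd_measurable [measurable]: "sd \<in> borel_measurable borel"
  unfolding sd_def by measurable

lemma phi_measurable [measurable]: "phi \<in> borel_measurable borel"
  unfolding phi_def by measurable

lemma tphi_measurable [measurable]: "tphi M \<in> borel_measurable borel"
  unfolding tphi_def by measurable

lemma dbl_measurable [measurable]: "dbl \<in> borel_measurable borel"
  unfolding dbl_def frac_def by measurable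

lemma dbl_funpow_measurable [measurable]: "(dbl ^^ n) \<in> borel_measurable borel"
  by (induction n) (auto simp: comp_def intro: measurable_compose[OF _ dbl_measurable])

text \<open>Summing the truncated integral \<open>I\<close> over \<open>n\<close> iterates gives
  \<open>n * I \<le> K * n + M\<close> for all \<open>n\<close>, so \<open>I \<le> K\<close> with no
  trace of the truncation level, and monotone convergence removes it. Truncation is what makes
  \<open>I\<close> finite beforehand, so that the comparison can be done in the reals.\<close>

lemma alpha_ne_MInf:
  assumes "controlled (1/2 - c) \<Lambda>"
  shows "alpha c \<noteq> - \<infinity>"
proof -
  define b where "b = 1/2 - c"
  define K where "K = 2 * \<Lambda> + 3"
  have ctl: "controlled b \<Lambda>" using assms by (simp add: b_def)
  interpret slow_return b \<Lambda> by (rule controlled_slow_return[OF ctl])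
  have K: "0 \<le> K" using Lam_nonneg by (simp add: K_def)
  have "integral_fc c \<mu> \<ge> - ereal K" if "\<mu> \<in> invariant_measures" for \<mu>
  proof -
    have sets[measurable_cong]: "sets \<mu> = sets borel" and "prob_space \<mu>" and inv: "distr \<mu> borel dbl = \<mu>"
      using that by (auto simp: invariant_measures_def)
    then interpret prob_space \<mu> by simp
    have inv_n: "(\<integral>\<^sup>+ x. g ((dbl ^^ n) x) \<partial>\<mu>) = (\<integral>\<^sup>+ x. g x \<partial>\<mu>)"
      if [measurable]: "g \<in> borel_measurable borel" for g :: "real \<Rightarrow> ennreal" and n
    proof (induction n)
      case (Suc n)
      have "(\<integral>\<^sup>+ x. g ((dbl ^^ n) x) \<partial>\<mu>) = (\<integral>\<^sup>+ x. g ((dbl ^^ n) x) \<partial>(distr \<mu> borel dbl))"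
        by (simp add: inv)
      also have "\<dots> = (\<integral>\<^sup>+ x. g ((dbl ^^ n) (dbl x)) \<partial>\<mu>)" by (rule nn_integral_distr) auto
      finally show ?case using Suc by (simp add: funpow_swap1)
    qed simp
    have bound: "(\<integral>\<^sup>+ x. ennreal (tphi M (x - b)) \<partial>\<mu>) \<le> ennreal K" if M: "0 \<le> M" for M
    proof -
      define I where "I = (\<integral>\<^sup>+ x. ennreal (tphi M (x - b)) \<partial>\<mu>)"
      have nI: "of_nat n * I \<le> ennreal (K * real n + M)" for n
      proof -
        have "of_nat n * I = (\<Sum>j<n. (\<integral>\<^sup>+ x. ennreal (tphi M ((dbl ^^ j) x - b)) \<partial>\<mu>))"
          using inv_n[of "\<lambda>x. ennreal (tphi M (x - b))"] by (simp add: I_def)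
        also have "\<dots> = (\<integral>\<^sup>+ x. (\<Sum>j<n. ennreal (tphi M ((dbl ^^ j) x - b))) \<partial>\<mu>)"
          by (rule nn_integral_sum[symmetric]) measurable
        also have "\<dots> \<le> (\<integral>\<^sup>+ x. ennreal (K * real n + M) \<partial>\<mu>)"
        proof (rule nn_integral_mono)
          fix x
          have "tphi M ((dbl ^^ j) x - b) = tphi M (2 ^ j * x - b)" for j
            by (simp add: tphi_def phi_def sd_dbl_funpow)
          then have "(\<Sum>j<n. ennreal (tphi M ((dbl ^^ j) x - b))) = ennreal (\<Sum>j<n. tphi M (2 ^ j * x - b))"
            using tphi_nonneg[OF M] by (simp add: sum_ennreal)
          also have "\<dots> \<le> ennreal (K * real n + M)"
            using truncated_birkhoff_bound[OF ctl M] by (intro ennreal_leI) (simp add: K_def)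
          finally show "(\<Sum>j<n. ennreal (tphi M ((dbl ^^ j) x - b))) \<le> ennreal (K * real n + M)" .
        qed
        also have "\<dots> = ennreal (K * real n + M)" by (simp add: emeasure_space_1)
        finally show ?thesis .
      qed
      have "I \<le> (\<integral>\<^sup>+ x. ennreal M \<partial>\<mu>)"
        unfolding I_def by (intro nn_integral_mono ennreal_leI tphi_le)
      also have "\<dots> = ennreal M" by (simp add: emeasure_space_1)
      finally have "I < \<infinity>" by (simp add: le_less_trans)
      then obtain i where i: "I = ennreal i" "0 \<le> i" by (cases I) auto
      have ni: "real n * i \<le> K * real n + M" for n
        using nI[of n] K M i(2) by (simp add: i(1) ennreal_of_nat_eq_real_of_nat del: ennreal_plus flip: ennreal_mult')
      have "i \<le> K"
      proof (rule ccontr)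
        assume "\<not> i \<le> K"
        then obtain n where "M < real n * (i - K)" using reals_Archimedean3[of "i - K"] by auto
        with ni[of n] show False by (simp add: algebra_simps)
      qed
      then show ?thesis using i by (simp add: I_def ennreal_leI)
    qed
    have "(\<integral>\<^sup>+ x. e2ennreal (- fc c x) \<partial>\<mu>) = (\<integral>\<^sup>+ x. (SUP i. ennreal (tphi (real i) (x - b))) \<partial>\<mu>)"
    proof (rule nn_integral_cong)
      fix x
      show "e2ennreal (- fc c x) = (SUP i. ennreal (tphi (real i) (x - b)))"
      proof (cases "sd (x - b) = 0")
        case True
        have "(SUP i. ennreal (real i)) = \<infinity>"
          using ennreal_SUP_of_nat_eq_top by (simp only: ennreal_of_nat_eq_real_of_nat infinity_ennreal_def)
        then show ?thesis using True by (simp only: neg_fc_conv_sd b_def tphi_def simp_thms if_True)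
      next
        case False
        obtain n where n: "phi (x - b) \<le> real n" using real_arch_simple by blast
        have "(SUP i. ennreal (tphi (real i) (x - b))) = ennreal (phi (x - b))"
        proof (rule antisym)
          show "(SUP i. ennreal (tphi (real i) (x - b))) \<le> ennreal (phi (x - b))"
            using False by (intro SUP_least ennreal_leI tphi_le_phi)
          show "ennreal (phi (x - b)) \<le> (SUP i. ennreal (tphi (real i) (x - b)))"
            using False n by (intro SUP_upper2[of n]) (auto simp: tphi_def)
        qed
        then show ?thesis using False by (simp add: neg_fc_conv_sd b_def)
      qed
    qed
    also have "\<dots> = (SUP i. (\<integral>\<^sup>+ x. ennreal (tphi (real i) (x - b)) \<partial>\<mu>))"
      by (rule nn_integral_monotone_convergence_SUP)
         (auto simp: incseq_def le_fun_def tphi_def intro!: ennreal_leI)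
    also have "\<dots> \<le> ennreal K" by (intro SUP_least bound) auto
    finally have "enn2ereal (\<integral>\<^sup>+ x. e2ennreal (- fc c x) \<partial>\<mu>) \<le> enn2ereal (ennreal K)"
      by (simp add: less_eq_ennreal.rep_eq)
    then show ?thesis using K unfolding integral_fc_def by (subst ereal_minus_le_minus) simp
  qed
  then have "- ereal K \<le> alpha c" unfolding alpha_def by (intro INF_greatest)
  then show ?thesis by auto
qed

text \<open>Only the measures equidistributed on periodic orbits are tested: their integrals are the
  periodic averages that \<open>periodic_bound\<close> asks for.\<close>

lemma ex_controlled_if_alpha:
  assumes "alpha c \<noteq> - \<infinity>"
  shows "\<exists>\<Lambda>. controlled (1/2 - c) \<Lambda>"
proof -
  define b where "b = 1/2 - c"
  obtain A where A: "0 \<le> A" "ereal (- A) \<le> alpha c"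
  proof (cases "alpha c")
    case (real r)
    then show ?thesis by (intro that[of "\<bar>r\<bar>"]) auto
  qed (use assms in \<open>auto intro: that[of 0]\<close>)
  have bound: "(\<Sum>j<n. e2ennreal (- fc c (2 ^ j * p))) \<le> ennreal (A * real n)"
    if n: "n \<ge> 1" and p: "2 ^ n * p - p \<in> \<int>" for n p
  proof -
    define U where "U = uniform_count_measure {..<n}"
    \<comment> \<open>Pushing forward the uniform measure on the indices counts points with
      multiplicity, so \<open>n\<close> may be any period of \<open>p\<close>, not just the
      least.\<close>
    define \<mu> where "\<mu> = distr U borel (\<lambda>j. frac (2 ^ j * p))"
    have U: "sets U = Pow {..<n}" "space U = {..<n}" by (auto simp: U_def sets_uniform_count_measure space_uniform_count_measure)
    have meas: "(\<lambda>j. g j) \<in> borel_measurable U" for g :: "nat \<Rightarrow> real"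
      by (rule measurableI) (auto simp: U)
    interpret U: prob_space U unfolding U_def using n by (intro prob_space_uniform_count_measure) (auto simp: lessThan_empty_iff)
    have nn: "(\<integral>\<^sup>+ j. h j \<partial>U) = (\<Sum>j<n. h j) / of_nat n" for h :: "nat \<Rightarrow> ennreal"
      unfolding U_def uniform_count_measure_def
      using n by (subst nn_integral_point_measure_finite)
         (auto simp: sum_distrib_right[symmetric] divide_ennreal[symmetric] ennreal_of_nat_eq_real_of_nat
           divide_ennreal_def mult.commute)
    have "distr \<mu> borel dbl = distr U borel (dbl \<circ> (\<lambda>j. frac (2 ^ j * p)))"
      unfolding \<mu>_def by (rule distr_distr) (auto intro: meas)
    also have "\<dots> = \<mu>"
    proof (rule measure_eqI)
      fix B assume "B \<in> sets (distr U borel (dbl \<circ> (\<lambda>j. frac (2 ^ j * p))))"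
      then have [measurable]: "B \<in> sets borel" by simp
      define h where "h = (\<lambda>j::nat. indicator B (frac (2 ^ j * p)) :: ennreal)"
      have hn: "h n = h 0"
        using p frac_eq_iff[of "2 ^ n * p" p] by (simp add: h_def)
      have d: "dbl (frac (2 ^ j * p)) = frac (2 ^ Suc j * p)" for j
        using dbl_funpow[of "Suc j" p] dbl_funpow[of j p] by simp
      have "emeasure (distr U borel (dbl \<circ> (\<lambda>j. frac (2 ^ j * p)))) B = (\<integral>\<^sup>+ j. h (Suc j) \<partial>U)"
        by (subst nn_integral_indicator[symmetric], simp, subst nn_integral_distr)
           (auto simp: h_def d comp_def intro: meas)
      also have "\<dots> = (\<integral>\<^sup>+ j. h j \<partial>U)"
      proof -
        \<comment> \<open>The orbit closes up, \<open>h n = h 0\<close>, so the shifted sum has the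
          same terms; \<open>h 0\<close> is finite and can be cancelled in
          \<open>ennreal\<close>.\<close>
        have "h 0 + (\<Sum>j<n. h (Suc j)) = h 0 + (\<Sum>j<n. h j)"
          using sum.lessThan_Suc_shift[of h n] hn by (simp only: sum.lessThan_Suc add.commute)
        moreover have "h 0 \<noteq> \<infinity>" by (auto simp: h_def indicator_def)
        ultimately have "(\<Sum>j<n. h (Suc j)) = (\<Sum>j<n. h j)"
          unfolding ennreal_add_left_cancel by blast
        then show ?thesis by (simp add: nn)
      qed
      also have "\<dots> = emeasure \<mu> B"
        unfolding \<mu>_def
        by (subst nn_integral_indicator[symmetric], simp, subst nn_integral_distr)
           (auto simp: h_def intro: meas)
      finally show "emeasure (distr U borel (dbl \<circ> (\<lambda>j. frac (2 ^ j * p)))) B = emeasure \<mu> B" .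
    qed (simp add: \<mu>_def)
    finally have "\<mu> \<in> invariant_measures"
      unfolding invariant_measures_def using U.prob_space_distr[OF meas, of "\<lambda>j. frac (2 ^ j * p)"]
      by (simp add: \<mu>_def)
    then have "alpha c \<le> integral_fc c \<mu>" unfolding alpha_def by (rule INF_lower)
    then have "enn2ereal (\<integral>\<^sup>+ x. e2ennreal (- fc c x) \<partial>\<mu>) \<le> ereal A"
      using A(2) unfolding integral_fc_def
      by (metis ereal_uminus_le_reorder order_trans uminus_ereal.simps(1) ereal_minus_le_minus)
    also have "ereal A = enn2ereal (ennreal A)" using A(1) by simp
    finally have "(\<integral>\<^sup>+ x. e2ennreal (- fc c x) \<partial>\<mu>) \<le> ennreal A" by (simp add: less_eq_ennreal.rep_eq)
    also have "(\<integral>\<^sup>+ x. e2ennreal (- fc c x) \<partial>\<mu>) = (\<integral>\<^sup>+ j. e2ennreal (- fc c (frac (2 ^ j * p))) \<partial>U)"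
      unfolding \<mu>_def
    proof (rule nn_integral_distr)
      show "(\<lambda>j. frac (2 ^ j * p)) \<in> U \<rightarrow>\<^sub>M borel" by (rule meas)
      show "(\<lambda>x. e2ennreal (- fc c x)) \<in> borel_measurable (distr U borel (\<lambda>j. frac (2 ^ j * p)))"
        unfolding neg_fc_conv_sd by measurable
    qed
    also have "\<dots> = (\<Sum>j<n. e2ennreal (- fc c (2 ^ j * p))) / of_nat n"
    proof -
      have "e2ennreal (- fc c (frac x)) = e2ennreal (- fc c x)" for x
      proof -
        have "sd (frac x - b) = sd (x - b)" by (intro sd_cong_Ints) (simp add: frac_def)
        then show ?thesis by (simp add: neg_fc_conv_sd b_def phi_def)
      qed
      then show ?thesis by (simp add: nn)
    qed
    finally have "(\<Sum>j<n. e2ennreal (- fc c (2 ^ j * p))) / of_nat n * of_nat n \<le> ennreal A * of_nat n"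
      by (rule mult_right_mono) simp
    moreover have "s / of_nat n * of_nat n = s" for s :: ennreal
      using n by (simp add: ennreal_divide_times ennreal_divide_self ennreal_of_nat_eq_real_of_nat)
    ultimately show ?thesis using A(1) by (simp add: ennreal_mult'' ennreal_of_nat_eq_real_of_nat)
  qed
  interpret periodic_bound b A
  proof
    show "0 \<le> A" by (fact A(1))
    fix n :: nat and p :: real assume n: "n \<ge> 1" and p: "2 ^ n * p - p \<in> \<int>"
    have sd_ne: "sd (2 ^ j * p - b) \<noteq> 0" if "j < n" for j
    proof
      assume "sd (2 ^ j * p - b) = 0"
      then have "e2ennreal (- fc c (2 ^ j * p)) = \<infinity>" by (simp add: neg_fc_conv_sd b_def)
      moreover have "e2ennreal (- fc c (2 ^ j * p)) \<le> (\<Sum>j<n. e2ennreal (- fc c (2 ^ j * p)))"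
        using that by (intro member_le_sum) auto
      ultimately have "\<infinity> \<le> ennreal (A * real n)" using bound[OF n p] by (metis order_trans)
      then show False by (simp add: top_unique)
    qed
    then show "0 < sd (2 ^ j * p - b)" if "j < n" for j using that by (simp add: less_le)
    have "ennreal (\<Sum>j<n. phi (2 ^ j * p - b)) = (\<Sum>j<n. e2ennreal (- fc c (2 ^ j * p)))"
      using sd_ne by (subst sum_ennreal[symmetric]) (auto simp: neg_fc_conv_sd b_def intro!: sum.cong)
    then show "(\<Sum>j<n. phi (2 ^ j * p - b)) \<le> A * real n"
      using bound[OF n p] A(1) by (metis ennreal_le_iff mult_nonneg_nonneg of_nat_0_le_iff)
  qed
  show ?thesis using ex_controlled by (simp add: b_def)
qed

lemma alpha_eq_MInf_iff: "alpha c = - \<infinity> \<longleftrightarrow> \<not> (\<exists>\<Lambda>. controlled (1/2 - c) \<Lambda>)"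
  using alpha_ne_MInf ex_controlled_if_alpha by blast

section \<open>Pre-periodic points and Baire category\<close>

lemma periodic_pt_iff: "periodic_pt b \<longleftrightarrow> (\<exists>p>0. sd (2 ^ p * b - b) = 0)"
  unfolding periodic_pt_def dbl_funpow frac_eq_iff sd_eq_0_iff by simp

lemma preperiodic_pt_iff: "preperiodic_pt b \<longleftrightarrow> (\<exists>n p. p > 0 \<and> 2 ^ (n + p) * b - 2 ^ n * b \<in> \<int>)"
  unfolding preperiodic_pt_def dbl_funpow frac_eq_iff by simp

lemma controlled_not_periodic: "controlled b \<Lambda> \<Longrightarrow> \<not> periodic_pt b"
  unfolding periodic_pt_iff controlled_def by (metis One_nat_def Suc_leI less_irrefl)

text \<open>From time \<open>n\<close> on the return distances repeat with period \<open>p\<close>,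
  so they take finitely many values, none of them 0, and \<open>phi\<close> is bounded along the
  returns.\<close>

lemma preperiodic_controlled:
  assumes "preperiodic_pt b" "\<not> periodic_pt b"
  shows "\<exists>\<Lambda>. controlled b \<Lambda>"
proof -
  obtain n p where p: "p > 0" "2 ^ (n + p) * b - 2 ^ n * b \<in> \<int>"
    using assms(1) by (auto simp: preperiodic_pt_iff)
  have pos: "0 < sd (2 ^ k * b - b)" if "k \<ge> 1" for k
  proof -
    have "sd (2 ^ k * b - b) \<noteq> 0"
    proof
      assume "sd (2 ^ k * b - b) = 0"
      then have "periodic_pt b" unfolding periodic_pt_iff using that by (intro exI[of _ k]) auto
      then show False using assms(2) by simp
    qed
    then show ?thesis using sd_nonneg[of "2 ^ k * b - b"] by linarith
  qed
  \<comment> \<open>For \<open>n = 0\<close> the point would be periodic. With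
    \<open>n \<ge> 1\<close> the reduction from \<open>k\<close> to \<open>k - p\<close> below never
    reaches the trivial return at index 0.\<close>
  have n: "n \<ge> 1" using p pos[of p] by (cases n) (auto simp: sd_eq_0_iff[symmetric])
  have per: "sd (2 ^ (k + p) * b - b) = sd (2 ^ k * b - b)" if "k \<ge> n" for k
  proof (rule sd_cong_Ints)
    have "(2 ^ (k + p) * b - b) - (2 ^ k * b - b) = 2 ^ (k - n) * (2 ^ (n + p) * b - 2 ^ n * b)"
      using that by (simp add: algebra_simps flip: power_add)
    also have "\<dots> \<in> \<int>" using p(2) by (intro Ints_mult Ints_power) auto
    finally show "(2 ^ (k + p) * b - b) - (2 ^ k * b - b) \<in> \<int>" .
  qed
  define L where "L = (\<Sum>k=1..<n + p. phi (2 ^ k * b - b))"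
  have le: "phi (2 ^ k * b - b) \<le> L" if "k \<ge> 1" for k
    using that
  proof (induction k rule: less_induct)
    case (less k)
    show ?case
    proof (cases "k < n + p")
      case True
      then show ?thesis unfolding L_def using less.prems
        by (intro member_le_sum[where f = "\<lambda>k. phi (2 ^ k * b - b)"]) auto
    next
      case False
      then have "phi (2 ^ k * b - b) = phi (2 ^ (k - p) * b - b)"
        using per[of "k - p"] by (simp add: phi_def)
      also have "\<dots> \<le> L" using False n p(1) by (intro less.IH) auto
      finally show ?thesis .
    qed
  qed
  have "ret_sum b m \<le> L * real m" for m
    using sum_mono[of "{1..m}" "\<lambda>k. phi (2 ^ k * b - b)" "\<lambda>k. L"] le
    by (simp add: ret_sum_def mult.commute)
  then show ?thesis using pos by (auto simp: controlled_def)
qed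

lemma periodic_dense:
  fixes u v :: real
  assumes "u < v"
  obtains x n where "u < x" "x < v" "n \<ge> 1" "sd (2 ^ n * x - x) = 0"
proof -
  obtain n :: nat where n: "1 / (v - u) < 2 ^ n" using real_arch_pow[of 2 "1 / (v - u)"] by auto
  define q where "q = (2::real) ^ Suc n - 1"
  have "(1::real) \<le> 2 ^ n" by simp
  then have q: "q > 0" "q \<ge> 2 ^ n" unfolding q_def power_Suc by linarith+
  have "1 < (v - u) * 2 ^ n" using n assms by (simp add: field_simps)
  also have "\<dots> \<le> (v - u) * q" using q assms by (intro mult_left_mono) auto
  finally have gap: "1 < v * q - u * q" by (simp add: algebra_simps)
  define t where "t = real_of_int (\<lfloor>u * q\<rfloor> + 1)"
  have t: "u * q < t" "t < v * q" using gap unfolding t_def by linarith+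
  show ?thesis
  proof
    show "u < t / q" "t / q < v" using t q by (auto simp: field_simps)
    have "2 ^ Suc n * (t / q) - t / q = q * (t / q)" by (simp only: q_def left_diff_distrib mult_1)
    also have "\<dots> = t" using q by simp
    finally show "sd (2 ^ Suc n * (t / q) - t / q) = 0" by (simp add: sd_eq_0_iff t_def)
  qed simp
qed

text \<open>The sets \<open>F L\<close> of exponentially slow return are relatively closed, each
  condition being continuous in \<open>c\<close>. Density of periodic points, where some return
  distance vanishes, leaves them no interior. Slow return suffices here; linear sums need not be
  formed.\<close>

lemma meagre_alpha_finite:
  "meagre_in (top_of_set {0..<1}) ({0..<1} - {c. alpha c = - \<infinity>})"
proof -
  define F where "F = (\<lambda>L::nat. {c \<in> {0..<1}. \<forall>n\<ge>1. exp (- real L * real n) \<le> sd (2 ^ n * (1/2 - c) - (1/2 - c))})"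
  let ?X = "top_of_set {0..<1::real}"
  have cover: "\<exists>L. c \<in> F L" if c: "c \<in> {0..<1} - {c. alpha c = - \<infinity>}" for c
  proof -
    obtain \<Lambda> where "controlled (1/2 - c) \<Lambda>" using c ex_controlled_if_alpha[of c] by blast
    then interpret slow_return "1/2 - c" \<Lambda> by (rule controlled_slow_return)
    obtain L :: nat where L: "\<Lambda> \<le> real L" using real_arch_simple by blast
    have "exp (- real L * real n) \<le> sd (2 ^ n * (1/2 - c) - (1/2 - c))" if "n \<ge> 1" for n
      using sd_return[OF that] L mult_right_mono[OF L, of "real n"] by (smt (verit) exp_le_cancel_iff mult_minus_left of_nat_0_le_iff)
    then show ?thesis using c by (auto simp: F_def)
  qed
  have nd: "?X interior_of (?X closure_of F L) = {}" for L
  proof -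
    have "closedin ?X (F L)"
    proof -
      define G where "G = (\<Inter>n\<in>{1::nat..}. {c. exp (- real L * real n) \<le> sd (2 ^ n * (1/2 - c) - (1/2 - c))})"
      have "closed G"
        unfolding sd_def G_def by (intro closed_INT ballI closed_Collect_le continuous_intros)
      moreover have "F L = {0..<1} \<inter> G" by (auto simp: F_def G_def)
      ultimately show ?thesis by (auto simp: closedin_closed)
    qed
    then have cl: "?X closure_of F L = F L" by (rule closure_of_closedin)
    have "c \<notin> ?X interior_of F L" for c
    proof
      assume "c \<in> ?X interior_of F L"
      then obtain T where T: "openin ?X T" "c \<in> T" "T \<subseteq> F L" by (auto simp: interior_of_def)
      then obtain S where S: "open S" "T = {0..<1} \<inter> S" by (metis openin_open)
      obtain e where e: "e > 0" "ball c e \<subseteq> S" using S T by (metis IntE open_contains_ball)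
      have c: "0 \<le> c" "c < 1" using S T by auto
      \<comment> \<open>The search goes only to the right of \<open>c\<close>, capped at 1, so that
        the parameter found stays inside [0,1) even when \<open>c = 0\<close>.\<close>
      define d where "d = min (c + e) 1"
      have "1/2 - d < 1/2 - c" using e c by (simp add: d_def)
      then obtain x n where x: "1/2 - d < x" "x < 1/2 - c" "n \<ge> 1" "sd (2 ^ n * x - x) = 0"
        by (rule periodic_dense)
      have "1/2 - x \<in> T" unfolding S(2)
        using x c e(2) by (auto simp: d_def subset_iff dist_real_def)
      then have "exp (- real L * real n) \<le> sd (2 ^ n * x - x)" using T(3) x(3) by (auto simp: F_def)
      then show False using x(4) exp_gt_zero[of "- real L * real n"] by linarith
    qed
    then show ?thesis by (auto simp: cl)
  qed
  show ?thesis unfolding meagre_in_def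
  proof (intro exI[of _ F] conjI allI)
    show "{0..<1} - {c. alpha c = - \<infinity>} \<subseteq> (\<Union>L. F L)" using cover by blast
    show "F L \<subseteq> topspace ?X" for L by (auto simp: F_def)
  qed (rule nd)
qed

section \<open>Parsing orbits into copies of their prefixes\<close>

text \<open>A coding of the first \<open>n\<close> binary digits of \<open>b\<close>:
  \<open>f\<close> of them are free, the others form blocks of length at least \<open>M\<close> that
  repeat an initial block. Repetition is expressed by closeness of \<open>2 ^ k * b\<close> to
  \<open>b\<close> on the circle instead of equality of digits, which avoids carries;
  \<open>1 \<le> k\<close> forbids copying a prefix onto itself.\<close>

inductive parse :: "nat \<Rightarrow> real \<Rightarrow> nat \<Rightarrow> nat \<Rightarrow> bool" for M :: nat and b :: real where
  parse_0: "parse M b 0 0"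
| parse_free: "parse M b n f \<Longrightarrow> parse M b (Suc n) (Suc f)"
| parse_copy: "parse M b k f \<Longrightarrow> 1 \<le> k \<Longrightarrow> M \<le> l \<Longrightarrow> 2 ^ l * sd (2 ^ k * b - b) \<le> 1 \<Longrightarrow> parse M b (k + l) f"

lemma parse_le: "parse M b n f \<Longrightarrow> f \<le> n"
  by (induction rule: parse.induct) auto

lemma parse_free_add: "parse M b n f \<Longrightarrow> parse M b (n + j) (f + j)"
  by (induction j) (auto intro: parse_free)

section \<open>Greedy parsing under slow return\<close>

context slow_return
begin

text \<open>One greedy step from position \<open>k\<close>: a single free digit when the approach to
  \<open>b\<close> has moderate depth, otherwise a copied block as long as the escape time. The
  factor \<open>M\<close> in the depth bound lets one inequality cover both cases.\<close>

definition segment_length :: "nat \<Rightarrow> nat \<Rightarrow> nat \<Rightarrow> bool" where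
  "segment_length M k t \<longleftrightarrow> t \<ge> 1 \<and>
     phi (2 ^ k * b - b) \<le> (\<Lambda> + 2) * real M * real t \<and>
     (\<forall>j\<in>{1..<t}. phi (2 ^ (k + j) * b - b) \<le> phi (2 ^ j * b - b) + 1) \<and>
     (t = 1 \<or> M \<le> t \<and> 2 ^ t * sd (2 ^ k * b - b) \<le> 1)"

lemma ex_segment_length:
  assumes "k \<ge> 1" "M \<ge> 2"
  shows "\<exists>t. segment_length M k t"
proof (cases "phi (2 ^ k * b - b) \<le> (\<Lambda> + 2) * real M")
  case True
  then show ?thesis by (intro exI[of _ 1]) (auto simp: segment_length_def)
next
  case False
  obtain t where t: "t \<ge> 1" "phi (2 ^ k * b - b) \<le> (\<Lambda> + 2) * real t"
    "\<forall>j\<in>{1..<t}. 0 < sd (2 ^ j * (2 ^ k * b) - b) \<and> phi (2 ^ j * (2 ^ k * b) - b) \<le> phi (2 ^ j * b - b) + 1"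
    "t \<ge> 2 \<longrightarrow> 2 ^ t * sd (2 ^ k * b - b) \<le> 1"
    using segment[OF sd_return_pos[OF assms(1)]] by metis
  \<comment> \<open>A depth beyond \<open>(\<Lambda> + 2) * M\<close> forces an escape time above
    \<open>M\<close>, so the block is long enough to be a copy.\<close>
  have "(\<Lambda> + 2) * real M < (\<Lambda> + 2) * real t" using False t(2) by linarith
  then have "M < t" using Lam_nonneg by simp
  moreover have "phi (2 ^ k * b - b) \<le> (\<Lambda> + 2) * real M * real t"
  proof -
    have "(\<Lambda> + 2) * real t * 1 \<le> (\<Lambda> + 2) * real t * real M"
      using Lam_nonneg assms by (intro mult_left_mono) auto
    then show ?thesis using t(2) by (simp add: mult_ac)
  qed
  ultimately show ?thesis using t assms
    by (intro exI[of _ t]) (auto simp: segment_length_def power_add mult_ac)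
qed

lemma ret_sum_segment:
  assumes k: "k \<ge> 1" and t: "segment_length M k t" and r: "r < t"
  shows "ret_sum b (k + r) \<le> ret_sum b (k - 1) + phi (2 ^ k * b - b) + real r + ret_sum b r"
  using r
proof (induction r)
  case 0
  have "ret_sum b (Suc (k - 1)) = ret_sum b (k - 1) + phi (2 ^ Suc (k - 1) * b - b)" by (rule ret_sum_Suc)
  with k show ?case by simp
next
  case (Suc r)
  have "\<forall>j\<in>{1..<t}. phi (2 ^ (k + j) * b - b) \<le> phi (2 ^ j * b - b) + 1"
    using t by (simp add: segment_length_def)
  then have "phi (2 ^ (k + Suc r) * b - b) \<le> phi (2 ^ Suc r * b - b) + 1"
    by (rule bspec) (use Suc.prems in simp)
  then show ?case using Suc ret_sum_Suc[of b r] ret_sum_Suc[of b "k + r"] by simp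
qed

text \<open>The invariant charges \<open>\<sigma>\<close> only to the copied digits
  \<open>k - f\<close>: a copied block of length \<open>t\<close> shadows the start of the orbit of
  \<open>b\<close> and costs \<open>ret_sum b (t - 1)\<close>, which the hypothesis on shorter
  lengths bounds by \<open>\<sigma> * t\<close>. Free digits, block openings and shadowing errors
  cost a multiple of \<open>M\<close> per digit, independent of \<open>\<sigma>\<close>. The block
  in progress at time \<open>n\<close> is kept open, with start \<open>k\<close>.\<close>

lemma greedy_parse:
  assumes M: "M \<ge> 2" and \<sigma>: "0 \<le> \<sigma>" "\<And>m. m < N \<Longrightarrow> ret_sum b m \<le> \<sigma> * real m"
    and "1 \<le> n" "n \<le> N"
  shows "\<exists>k f t. 1 \<le> k \<and> k \<le> n \<and> n < k + t \<and> parse M b k f \<and> segment_length M k t \<and>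
    ret_sum b (k - 1) \<le> (\<Lambda> + 3) * real M * real k + \<sigma> * (real k - real f)"
  using \<open>1 \<le> n\<close> \<open>n \<le> N\<close>
proof (induction n rule: dec_induct)
  case base
  obtain t where "segment_length M 1 t" using ex_segment_length[of 1 M] M by auto
  moreover have "parse M b 1 1" using parse_free[OF parse_0] by simp
  ultimately show ?case using Lam_nonneg by (intro exI[of _ 1] exI[of _ t]) (auto simp: segment_length_def)
next
  case (step n)
  then obtain k f t where IH: "1 \<le> k" "k \<le> n" "n < k + t" "parse M b k f" "segment_length M k t"
    "ret_sum b (k - 1) \<le> (\<Lambda> + 3) * real M * real k + \<sigma> * (real k - real f)" by auto
  show ?case
  proof (cases "Suc n < k + t")
    case True
    then show ?thesis using IH by (intro exI[of _ k] exI[of _ f] exI[of _ t]) auto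
  next
    case False
    then have n: "Suc n = k + t" using IH(3) by simp
    have t: "t \<ge> 1" "phi (2 ^ k * b - b) \<le> (\<Lambda> + 2) * real M * real t" using IH(5) by (auto simp: segment_length_def)
    have "ret_sum b (k + (t - 1)) \<le> ret_sum b (k - 1) + phi (2 ^ k * b - b) + real (t - 1) + ret_sum b (t - 1)"
      using t by (intro ret_sum_segment[OF IH(1,5)]) auto
    moreover have "real (t - 1) \<le> real M * real t"
      using M mult_right_mono[of 1 "real M" "real t"] t(1) by linarith
    ultimately have le: "ret_sum b (k + t - 1) \<le> (\<Lambda> + 3) * real M * real (k + t) + \<sigma> * (real k - real f) + ret_sum b (t - 1)"
      using IH(6) t by (simp add: algebra_simps)
    obtain u where u: "segment_length M (k + t) u" using ex_segment_length[of "k + t" M] M IH(1) by auto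
    have "\<exists>f'. parse M b (k + t) f' \<and> \<sigma> * (real k - real f) + ret_sum b (t - 1) \<le> \<sigma> * (real (k + t) - real f')"
    proof (cases "t = 1")
      case True
      then show ?thesis using IH(4) by (intro exI[of _ "Suc f"]) (auto intro: parse_free)
    next
      case False
      then have "parse M b (k + t) f"
        using IH(1,4,5) by (intro parse_copy) (auto simp: segment_length_def)
      moreover have "ret_sum b (t - 1) \<le> \<sigma> * real (t - 1)" using IH n step by (intro \<sigma>(2)) auto
      moreover have "\<sigma> * real (t - 1) \<le> \<sigma> * real t" using \<sigma>(1) by (intro mult_left_mono) auto
      ultimately show ?thesis by (intro exI[of _ f]) (auto simp: algebra_simps)
    qed
    then obtain f' where "parse M b (k + t) f'"
      "\<sigma> * (real k - real f) + ret_sum b (t - 1) \<le> \<sigma> * (real (k + t) - real f')" by auto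
    then show ?thesis using le u IH(1) unfolding n
      by (intro exI[of _ "k + t"] exI[of _ f'] exI[of _ u]) (auto simp: segment_length_def)
  qed
qed

text \<open>The open last block is cut at \<open>n\<close>. If at least \<open>M\<close> of its
  digits are used it is still a copy; otherwise these fewer than \<open>M\<close> digits are
  declared free, which accounts for the extra \<open>\<sigma> * M\<close>. Its opening approach is
  bounded by slow return, since the cut block may be too short to pay for it.\<close>

lemma ret_sum_le_parse:
  assumes M: "M \<ge> 2" and \<sigma>: "0 \<le> \<sigma>" "\<And>m. m < n \<Longrightarrow> ret_sum b m \<le> \<sigma> * real m" and n: "1 \<le> n"
  shows "\<exists>f. parse M b n f \<and>
    ret_sum b n \<le> ((\<Lambda> + 3) * real M + \<Lambda> + 1) * real n + \<sigma> * (real n - real f + real M)"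
proof -
  obtain k f t where k: "1 \<le> k" "k \<le> n" "n < k + t" "parse M b k f" "segment_length M k t"
    "ret_sum b (k - 1) \<le> (\<Lambda> + 3) * real M * real k + \<sigma> * (real k - real f)"
    using greedy_parse[OF M \<sigma> n order_refl] by auto
  define r where "r = n - k"
  have n_eq: "n = k + r" and r: "r < t" using k by (auto simp: r_def)
  have "ret_sum b n \<le> ret_sum b (k - 1) + phi (2 ^ k * b - b) + real r + ret_sum b r"
    unfolding n_eq by (rule ret_sum_segment[OF k(1,5) r])
  moreover have "phi (2 ^ k * b - b) \<le> \<Lambda> * real k" by (rule phi_return[OF k(1)])
  moreover have "ret_sum b r \<le> \<sigma> * real r" using k(1) n_eq by (intro \<sigma>(2)) auto
  moreover have "0 \<le> (\<Lambda> + 3) * real M * real r" "0 \<le> \<Lambda> * real r" using Lam_nonneg by auto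
  ultimately have le: "ret_sum b n \<le> ((\<Lambda> + 3) * real M + \<Lambda> + 1) * real n + \<sigma> * (real n - real f)"
    using k(6) by (simp add: n_eq algebra_simps)
  show ?thesis
  proof (cases "M \<le> r")
    case True
    then have "2 ^ t * sd (2 ^ k * b - b) \<le> 1" using k(5) r M by (auto simp: segment_length_def)
    moreover have "2 ^ r * sd (2 ^ k * b - b) \<le> 2 ^ t * sd (2 ^ k * b - b)"
      using r by (intro mult_right_mono power_increasing) auto
    ultimately have "parse M b n f" unfolding n_eq using k True by (intro parse_copy) auto
    moreover have "0 \<le> \<sigma> * real M" using \<sigma> by simp
    ultimately show ?thesis using le by (intro exI[of _ f]) (auto simp: algebra_simps)
  next
    case False
    have "parse M b n (f + r)" unfolding n_eq by (rule parse_free_add[OF k(4)])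
    moreover have "\<sigma> * real r \<le> \<sigma> * real M" using \<sigma>(1) False by (intro mult_left_mono) auto
    ultimately show ?thesis using le by (intro exI[of _ "f + r"]) (auto simp: algebra_simps)
  qed
qed

end

text \<open>Bootstrapping by contradiction: if every long parse has a share of free digits above
  \<open>s\<close>, then \<open>\<sigma>\<close> is charged on at most a share \<open>1 - s\<close>
  of the digits, so the bound \<open>\<sigma> * m\<close> for shorter lengths reproduces itself at
  length \<open>n\<close> once \<open>\<sigma>\<close> is large. The return sums would then be
  linear.\<close>

lemma ex_sparse_parse:
  assumes unc: "\<nexists>\<Lambda>. controlled b \<Lambda>" and s: "0 < s" and M: "M \<ge> 2"
  shows "\<exists>n\<ge>N. \<exists>f. parse M b n f \<and> real f \<le> s * real n"
proof (rule ccontr)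
  assume "\<not> ?thesis"
  then have dense: "s * real n < real f" if "n \<ge> N" "parse M b n f" for n f
    using that by (meson not_le)
  obtain L0 :: nat where L0: "1 / s \<le> real L0" using real_arch_simple by blast
  define L where "L = Max {L0, N, M}"
  have L: "1 / s \<le> real L" "N \<le> L" "M \<le> L" using L0 by (auto simp: L_def)
  \<comment> \<open>Too close a return at time \<open>k\<close> would allow \<open>k\<close> free
    digits followed by one copied block of length \<open>L * k\<close>, a sparse parse; this yields
    slow return.\<close>
  have ret: "1 < 2 ^ (L * k) * sd (2 ^ k * b - b)" if k: "k \<ge> 1" for k
  proof (rule ccontr)
    assume "\<not> ?thesis"
    moreover have "parse M b k k" using parse_free_add[OF parse_0, of M b k] by simp
    moreover have Lk: "L \<le> L * k" using k by simp
    ultimately have "parse M b (k + L * k) k"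
      using k order_trans[OF L(3) Lk] by (intro parse_copy) auto
    then have "s * real (k + L * k) < real k" using order_trans[OF L(2) Lk] by (intro dense) (linarith, assumption)
    moreover have "real k \<le> s * real (L * k)"
    proof -
      have "1 \<le> s * real L" using L(1) s by (simp add: field_simps)
      then have "1 * real k \<le> s * real L * real k" by (rule mult_right_mono) simp
      then show ?thesis by simp
    qed
    moreover have "0 \<le> s * real k" using s by simp
    ultimately show False by (simp add: algebra_simps)
  qed
  interpret slow_return b "real L"
  proof
    fix k :: nat assume k: "k \<ge> 1"
    have "(2::real) ^ (L * k) \<le> exp 1 ^ (L * k)"
      using exp_ge_add_one_self[of 1] by (intro power_mono) auto
    also have "\<dots> = exp (real L * real k)" by (simp flip: exp_of_nat_mult)
    finally have "2 ^ (L * k) * sd (2 ^ k * b - b) \<le> exp (real L * real k) * sd (2 ^ k * b - b)"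
      by (rule mult_right_mono) simp
    then have "1 \<le> exp (real L * real k) * sd (2 ^ k * b - b)" using ret[OF k] by linarith
    then show "exp (- real L * real k) \<le> sd (2 ^ k * b - b)"
      by (simp add: exp_minus field_simps)
  qed simp
  define C where "C = (real L + 3) * real M + real L + 1"
  have C: "0 \<le> C" by (simp add: C_def)
  obtain N1 :: nat where N1: "2 * real M / s \<le> real N1" "N \<le> N1"
    using real_arch_simple[of "max (2 * real M / s) (real N)"] by auto
  \<comment> \<open>Half of the gain \<open>s * \<sigma> * n\<close> pays for \<open>C * n\<close>,
    the other half for \<open>\<sigma> * M\<close> when \<open>n > N1\<close>; the second entry of
    the maximum covers \<open>n \<le> N1\<close>.\<close>
  define \<sigma> where "\<sigma> = max (2 * C / s) (ret_sum b N1)"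
  have \<sigma>: "2 * C / s \<le> \<sigma>" "ret_sum b N1 \<le> \<sigma>" by (auto simp: \<sigma>_def)
  have \<sigma>0: "0 \<le> \<sigma>" using ret_sum_nonneg[of b N1] \<sigma> by linarith
  have "ret_sum b n \<le> \<sigma> * real n" for n
  proof (induction n rule: less_induct)
    case (less n)
    consider "n = 0" | "n \<ge> 1" "n \<le> N1" | "n \<ge> 1" "n > N1" by linarith
    then show ?case
    proof cases
      case 2
      have "ret_sum b n \<le> \<sigma>" using ret_sum_mono[OF 2(2), of b] \<sigma> by linarith
      also have "\<dots> \<le> \<sigma> * real n" using \<sigma>0 2 mult_left_mono[of 1 "real n" \<sigma>] by simp
      finally show ?thesis .
    next
      case 3
      obtain f where f: "parse M b n f" "ret_sum b n \<le> C * real n + \<sigma> * (real n - real f + real M)"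
        using ret_sum_le_parse[OF M \<sigma>0 less.IH 3(1)] by (auto simp: C_def)
      have "s * real n < real f" using dense[OF _ f(1)] 3 N1 by simp
      moreover have "real M \<le> s * real n / 2"
      proof -
        have "2 * real M / s \<le> real n" using N1 3 by linarith
        then show ?thesis using s by (simp add: field_simps)
      qed
      ultimately have "\<sigma> * (real n - real f + real M) \<le> \<sigma> * (real n - s * real n / 2)"
        using \<sigma>0 by (intro mult_left_mono) auto
      moreover have "2 * C / s * (s * real n / 2) \<le> \<sigma> * (s * real n / 2)"
        using \<sigma>(1) s by (intro mult_right_mono) auto
      ultimately show ?thesis using f(2) s by (simp add: algebra_simps)
    qed simp
  qed
  then have "controlled b \<sigma>" using sd_return_pos by (auto simp: controlled_def)
  with unc show False by blast
qed

section \<open>Counting cells and Hausdorff dimension\<close>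

lemma sum_UN_le:
  fixes g :: "'b \<Rightarrow> real"
  assumes "finite I" "\<And>i. i \<in> I \<Longrightarrow> finite (A i)" "\<And>x. 0 \<le> g x"
  shows "sum g (\<Union>i\<in>I. A i) \<le> (\<Sum>i\<in>I. sum g (A i))"
  using assms(1,2)
proof (induction I rule: finite_induct)
  case (insert i I)
  have "sum g (A i \<union> (\<Union>i\<in>I. A i)) \<le> sum g (A i) + sum g (\<Union>i\<in>I. A i)"
    using insert.prems insert.hyps sum.union_inter[of "A i" "\<Union>i\<in>I. A i" g] sum_nonneg[of "A i \<inter> (\<Union>i\<in>I. A i)" g] assms(3)
    by (smt (verit, ccfv_SIG) finite_UN_I insertCI)
  with insert show ?case by simp
qed simp

definition cells :: "nat \<Rightarrow> nat \<Rightarrow> (int \<times> nat) set" where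
  "cells M n = {(\<lfloor>2 ^ n * b\<rfloor>, f) | b f. - 1/2 \<le> b \<and> b \<le> 1/2 \<and> parse M b n f}"

definition copies :: "nat \<Rightarrow> int \<Rightarrow> nat \<Rightarrow> int set" where
  "copies k i l = {\<lfloor>2 ^ (k + l) * b\<rfloor> | b :: real. \<lfloor>2 ^ k * b\<rfloor> = i \<and> 2 ^ l * sd (2 ^ k * b - b) \<le> 1}"

lemma finite_cells: "finite (cells M n)"
proof (rule finite_subset)
  show "cells M n \<subseteq> {- (2 ^ n)..2 ^ n} \<times> {..n}"
  proof
    fix z assume "z \<in> cells M n"
    then obtain b f where z: "z = (\<lfloor>2 ^ n * b\<rfloor>, f)" "- 1/2 \<le> b" "b \<le> 1/2" "parse M b n f"
      by (auto simp: cells_def)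
    have le: "2 ^ n * - 1 \<le> 2 ^ n * b" "2 ^ n * b \<le> 2 ^ n * 1"
      using z by (intro mult_left_mono; simp)+
    have "- (2 ^ n) \<le> \<lfloor>2 ^ n * b\<rfloor>" using le(1) by (simp add: le_floor_iff)
    moreover have "\<lfloor>2 ^ n * b\<rfloor> \<le> 2 ^ n" using floor_mono[OF le(2)] by simp
    ultimately have "- (2 ^ n) \<le> \<lfloor>2 ^ n * b\<rfloor>" "\<lfloor>2 ^ n * b\<rfloor> \<le> 2 ^ n" .
    then show "z \<in> {- (2 ^ n)..2 ^ n} \<times> {..n}" using z(1) parse_le[OF z(4)] by simp
  qed
qed simp

text \<open>A close return puts \<open>(2 ^ k - 1) * b\<close> near an integer \<open>t\<close>.
  Fixing the cell of level \<open>k\<close> leaves three candidates for \<open>t\<close>, and each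
  \<open>t\<close> determines \<open>b\<close> up to \<open>1 / 2 ^ (k + l)\<close>, hence up to
  three cells. The bound does not depend on \<open>l\<close>: a copied block carries no
  entropy.\<close>

lemma copies_card:
  assumes "k \<ge> 1"
  shows "finite (copies k i l) \<and> card (copies k i l) \<le> 9"
proof -
  define q where "q = (2::real) ^ k - 1"
  have "(2::real) ^ 1 \<le> 2 ^ k" using assms by (intro power_increasing) auto
  then have q: "0 < q" "2 ^ k \<le> 2 * q" by (auto simp: q_def)
  \<comment> \<open>The value of \<open>q * b\<close> at the left end of the cell. Since
    \<open>q < 2 ^ k\<close>, the product moves by less than 1 over the cell, and rounding leaves
    three integers.\<close>
  define y where "y = q * of_int i / 2 ^ k"
  define F where "F = (\<lambda>(d::int, e::int). \<lfloor>2 ^ (k + l) * (of_int (\<lfloor>y\<rfloor> + d) / q)\<rfloor> + e)"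
  have sub: "copies k i l \<subseteq> F ` ({0..2} \<times> {-1..1})"
  proof
    fix j assume "j \<in> copies k i l"
    then obtain b where j: "j = \<lfloor>2 ^ (k + l) * b\<rfloor>" and b: "\<lfloor>2 ^ k * b\<rfloor> = i" "2 ^ l * sd (2 ^ k * b - b) \<le> 1"
      by (auto simp: copies_def)
    have qb: "2 ^ k * b - b = q * b" by (simp add: q_def algebra_simps)
    define t where "t = round (q * b)"
    have t: "\<bar>q * b - of_int t\<bar> \<le> 1/2"
      using of_int_round_abs_le[of "q * b"] by (simp add: t_def abs_minus_commute)
    have ib: "of_int i \<le> 2 ^ k * b" "2 ^ k * b < of_int i + 1" using b(1) by linarith+
    have "y \<le> q * b"
    proof -
      have "q * of_int i \<le> q * (2 ^ k * b)" using ib q by (intro mult_left_mono) auto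
      then show ?thesis by (simp add: y_def field_simps)
    qed
    moreover have "q * b < y + 1"
    proof -
      have "q * (2 ^ k * b) < q * (of_int i + 1)" using ib q by (intro mult_strict_left_mono) auto
      also have "\<dots> \<le> q * of_int i + 2 ^ k" by (simp add: q_def algebra_simps)
      finally show ?thesis by (simp add: y_def field_simps)
    qed
    ultimately have "0 \<le> t - \<lfloor>y\<rfloor>" "t - \<lfloor>y\<rfloor> \<le> 2" using t by linarith+
    moreover have "\<bar>2 ^ (k + l) * b - 2 ^ (k + l) * (of_int t / q)\<bar> \<le> 1"
    proof -
      have "2 ^ (k + l) * b - 2 ^ (k + l) * (of_int t / q) = 2 ^ (k + l) / q * (q * b - of_int t)"
        using q by (simp add: field_simps)
      then have "\<bar>2 ^ (k + l) * b - 2 ^ (k + l) * (of_int t / q)\<bar> = 2 ^ (k + l) / q * \<bar>q * b - of_int t\<bar>"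
        using q by (simp add: abs_mult)
      also have "\<dots> \<le> (2 * 2 ^ l) * (sd (q * b) / 2)"
      proof (intro mult_mono)
        show "2 ^ (k + l) / q \<le> 2 * 2 ^ l"
          using q mult_right_mono[of "2 ^ k" "2 * q" "2 ^ l"] by (simp add: power_add field_simps)
        show "\<bar>q * b - of_int t\<bar> \<le> sd (q * b) / 2" using sd_round[of "q * b"] by (simp add: t_def)
      qed auto
      also have "\<dots> \<le> 1" using b(2) by (simp add: qb)
      finally show ?thesis .
    qed
    then have "- 1 \<le> j - \<lfloor>2 ^ (k + l) * (of_int t / q)\<rfloor>" "j - \<lfloor>2 ^ (k + l) * (of_int t / q)\<rfloor> \<le> 1"
      unfolding j by linarith+
    ultimately show "j \<in> F ` ({0..2} \<times> {-1..1})"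
      by (intro image_eqI[of _ _ "(t - \<lfloor>y\<rfloor>, j - \<lfloor>2 ^ (k + l) * (of_int t / q)\<rfloor>)"]) (auto simp: F_def)
  qed
  have "card (copies k i l) \<le> card (F ` ({0..2} \<times> {-1..1}))" using sub by (intro card_mono) auto
  also have "\<dots> \<le> card ({0..2::int} \<times> {-1..1::int})" by (rule card_image_le) auto
  also have "\<dots> = 9" by simp
  finally show ?thesis using finite_subset[OF sub] by auto
qed

text \<open>A generating function in the number of free digits. A free digit at most doubles the
  number of cells, so the weight 1/4 turns it into a factor 1/2 and leaves room for the copied
  blocks.\<close>

definition weight :: "nat \<Rightarrow> nat \<Rightarrow> real" where
  "weight M n = (\<Sum>(i, f)\<in>cells M n. (1/4) ^ f)"

lemma cells_subset:
  assumes "n \<ge> 1" "M \<ge> 1"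
  shows "cells M n \<subseteq> (\<Union>z\<in>cells M (n - 1). {2 * fst z, 2 * fst z + 1} \<times> {Suc (snd z)}) \<union>
    (\<Union>k\<in>{1..n - M}. \<Union>z\<in>cells M k. copies k (fst z) (n - k) \<times> {snd z})" (is "_ \<subseteq> ?A \<union> ?B")
proof
  fix w assume "w \<in> cells M n"
  then obtain b f where w: "w = (\<lfloor>2 ^ n * b\<rfloor>, f)" and b: "- 1/2 \<le> b" "b \<le> 1/2" and p: "parse M b n f"
    by (auto simp: cells_def)
  from p show "w \<in> ?A \<union> ?B"
  proof cases
    case parse_0
    with assms show ?thesis by simp
  next
    case (parse_free m g)
    have "(\<lfloor>2 ^ m * b\<rfloor>, g) \<in> cells M m" using parse_free b by (auto simp: cells_def)
    moreover have "\<lfloor>2 ^ n * b\<rfloor> = 2 * \<lfloor>2 ^ m * b\<rfloor> \<or> \<lfloor>2 ^ n * b\<rfloor> = 2 * \<lfloor>2 ^ m * b\<rfloor> + 1"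
    proof -
      have "2 ^ n * b = 2 * (2 ^ m * b)" by (simp add: parse_free)
      then show ?thesis by linarith
    qed
    ultimately have "w \<in> ?A" using parse_free w by (intro UN_I[of "(\<lfloor>2 ^ m * b\<rfloor>, g)"]) auto
    then show ?thesis ..
  next
    case (parse_copy k l)
    have "(\<lfloor>2 ^ k * b\<rfloor>, f) \<in> cells M k" using parse_copy b by (auto simp: cells_def)
    moreover have "\<lfloor>2 ^ n * b\<rfloor> \<in> copies k \<lfloor>2 ^ k * b\<rfloor> (n - k)" using parse_copy by (auto simp: copies_def)
    ultimately have "w \<in> ?B" using parse_copy w
      by (intro UN_I[of k] UN_I[of "(\<lfloor>2 ^ k * b\<rfloor>, f)"]) auto
    then show ?thesis ..
  qed
qed

lemma weight_rec:
  assumes "n \<ge> 1" "M \<ge> 1"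
  shows "weight M n \<le> 1/2 * weight M (n - 1) + 9 * (\<Sum>k=1..n - M. weight M k)"
proof -
  define g where "g = (\<lambda>z :: int \<times> nat. (1/4 :: real) ^ snd z)"
  have g: "0 \<le> g z" for z by (simp add: g_def)
  have wg: "weight M m = sum g (cells M m)" for m by (simp add: weight_def g_def split_def)
  let ?A = "\<Union>z\<in>cells M (n - 1). {2 * fst z, 2 * fst z + 1} \<times> {Suc (snd z)}"
  let ?B = "\<Union>k\<in>{1..n - M}. \<Union>z\<in>cells M k. copies k (fst z) (n - k) \<times> {snd z}"
  have fin: "finite ?A" "finite ?B" using finite_cells copies_card by auto
  have "weight M n \<le> sum g (?A \<union> ?B)"
    unfolding wg using fin g by (intro sum_mono2 cells_subset assms) auto
  also have "\<dots> \<le> sum g ?A + sum g ?B"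
    using sum.union_inter[OF fin, of g] sum_nonneg[of "?A \<inter> ?B" g] g by simp
  also have "sum g ?A \<le> (\<Sum>z\<in>cells M (n - 1). sum g ({2 * fst z, 2 * fst z + 1} \<times> {Suc (snd z)}))"
    using finite_cells g by (intro sum_UN_le) auto
  also have "\<dots> = (\<Sum>z\<in>cells M (n - 1). 1/2 * g z)"
    by (intro sum.cong refl) (auto simp: g_def sum.cartesian_product[symmetric] sum.insert)
  also have "\<dots> = 1/2 * weight M (n - 1)" by (simp add: wg sum_distrib_left)
  also have "sum g ?B \<le> (\<Sum>k=1..n - M. sum g (\<Union>z\<in>cells M k. copies k (fst z) (n - k) \<times> {snd z}))"
    using finite_cells copies_card g by (intro sum_UN_le) auto
  also have "\<dots> \<le> (\<Sum>k=1..n - M. 9 * weight M k)"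
  proof (rule sum_mono)
    fix k assume k: "k \<in> {1..n - M}"
    have "sum g (\<Union>z\<in>cells M k. copies k (fst z) (n - k) \<times> {snd z}) \<le>
        (\<Sum>z\<in>cells M k. sum g (copies k (fst z) (n - k) \<times> {snd z}))"
      using finite_cells copies_card k g by (intro sum_UN_le) auto
    also have "\<dots> = (\<Sum>z\<in>cells M k. real (card (copies k (fst z) (n - k))) * g z)"
    proof (intro sum.cong refl)
      fix z
      have "sum g (copies k (fst z) (n - k) \<times> {snd z}) = (\<Sum>w\<in>copies k (fst z) (n - k) \<times> {snd z}. g z)"
        by (intro sum.cong refl) (auto simp: g_def)
      then show "sum g (copies k (fst z) (n - k) \<times> {snd z}) = real (card (copies k (fst z) (n - k))) * g z"
        by (simp add: card_cartesian_product)
    qed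
    also have "\<dots> \<le> (\<Sum>z\<in>cells M k. 9 * g z)"
      using copies_card[of k] k g by (intro sum_mono mult_right_mono) auto
    also have "\<dots> = 9 * weight M k" by (simp add: wg sum_distrib_left)
    finally show "sum g (\<Union>z\<in>cells M k. copies k (fst z) (n - k) \<times> {snd z}) \<le> 9 * weight M k" .
  qed
  finally show ?thesis by (simp add: sum_distrib_left)
qed

text \<open>Half of \<open>2 * \<beta> ^ n\<close> is spent on a final free digit and half on a
  final copied block. The latter starts at least \<open>M\<close> positions back, so its geometric
  sum, with the factor 18 = 9 * 2, is at most \<open>\<beta> ^ n\<close> under the condition on
  \<open>M\<close>. The leading 2 counts the cells of level 0.\<close>

lemma weight_le:
  assumes \<beta>: "\<beta> > 1" and M: "M \<ge> 1" "18 * \<beta> \<le> \<beta> ^ M * (\<beta> - 1)"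
  shows "weight M n \<le> 2 * \<beta> ^ n"
proof (induction n rule: less_induct)
  case (less n)
  show ?case
  proof (cases "n = 0")
    case True
    have "cells M 0 \<subseteq> {(-1, 0), (0, 0)}"
    proof
      fix z assume "z \<in> cells M 0"
      then obtain b f where z: "z = (\<lfloor>b\<rfloor>, f)" "- 1/2 \<le> b" "b \<le> 1/2" "parse M b 0 f"
        by (auto simp: cells_def)
      then have "\<lfloor>b\<rfloor> = - 1 \<or> \<lfloor>b\<rfloor> = 0" "f = 0" using parse_le[OF z(4)] by linarith+
      with z show "z \<in> {(-1, 0), (0, 0)}" by auto
    qed
    then have "weight M 0 \<le> (\<Sum>(i, f)\<in>{(-1::int, 0::nat), (0, 0)}. (1/4) ^ f)"
      unfolding weight_def by (intro sum_mono2) auto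
    then show ?thesis using True by simp
  next
    case False
    then have n: "n \<ge> 1" by simp
    have geo: "(\<Sum>k=1..m. \<beta> ^ k) * (\<beta> - 1) \<le> \<beta> ^ Suc m" for m
    proof (induction m)
      case (Suc m)
      then show ?case using \<beta> by (simp add: algebra_simps)
    qed (use \<beta> in simp)
    have "9 * (\<Sum>k=1..n - M. weight M k) \<le> 18 * (\<Sum>k=1..n - M. \<beta> ^ k)"
      using sum_mono[of "{1..n - M}" "weight M" "\<lambda>k. 2 * \<beta> ^ k"] less.IH M n
      by (force simp: sum_distrib_left[symmetric])
    also have "\<dots> \<le> \<beta> ^ n"
    proof (cases "M \<le> n")
      case True
      have "18 * (\<Sum>k=1..n - M. \<beta> ^ k) * (\<beta> - 1) \<le> 18 * \<beta> ^ Suc (n - M)"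
        using geo[of "n - M"] by simp
      also have "\<dots> = 18 * \<beta> * \<beta> ^ (n - M)" by simp
      also have "\<dots> \<le> \<beta> ^ M * (\<beta> - 1) * \<beta> ^ (n - M)"
        using \<beta> M by (intro mult_right_mono) auto
      also have "\<dots> = \<beta> ^ n * (\<beta> - 1)" using True by (simp add: mult_ac flip: power_add)
      finally show ?thesis using \<beta> by simp
    next
      case False
      then show ?thesis using \<beta> by simp
    qed
    moreover have "1/2 * weight M (n - 1) \<le> \<beta> ^ n"
    proof -
      have "1/2 * weight M (n - 1) \<le> \<beta> ^ (n - 1)" using less.IH[of "n - 1"] n by simp
      also have "\<dots> \<le> \<beta> ^ n" using \<beta> by (intro power_increasing) auto
      finally show ?thesis .
    qed
    ultimately show ?thesis using weight_rec[OF n M(1)] by simp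
  qed
qed

definition sparse_cells :: "nat \<Rightarrow> real \<Rightarrow> nat \<Rightarrow> int set" where
  "sparse_cells M s n = fst ` {z \<in> cells M n. real (snd z) \<le> s * real n}"

lemma finite_sparse_cells: "finite (sparse_cells M s n)"
  unfolding sparse_cells_def using finite_cells by (intro finite_imageI) auto

text \<open>Exponential Markov inequality: a sparse cell has weight at least
  \<open>4 powr (- s * n)\<close>.\<close>

lemma card_sparse_cells:
  assumes "\<beta> > 1" "M \<ge> 1" "18 * \<beta> \<le> \<beta> ^ M * (\<beta> - 1)"
  shows "real (card (sparse_cells M s n)) \<le> 2 * (\<beta> * 4 powr s) ^ n"
proof -
  let ?Q = "{z \<in> cells M n. real (snd z) \<le> s * real n}"
  have fin: "finite ?Q" using finite_cells by auto
  have "real (card (sparse_cells M s n)) \<le> (\<Sum>z\<in>?Q. 1)"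
    unfolding sparse_cells_def using card_image_le[OF fin, of fst] by simp
  also have "\<dots> \<le> (\<Sum>z\<in>?Q. 4 powr (s * real n) * (1/4) ^ snd z)"
  proof (rule sum_mono)
    fix z assume "z \<in> ?Q"
    then have "4 powr real (snd z) \<le> 4 powr (s * real n)" by (intro powr_mono) auto
    then show "1 \<le> 4 powr (s * real n) * (1/4) ^ snd z"
      by (simp add: powr_realpow power_divide)
  qed
  also have "\<dots> \<le> (\<Sum>z\<in>cells M n. 4 powr (s * real n) * (1/4) ^ snd z)"
    using finite_cells by (intro sum_mono2) auto
  also have "\<dots> = 4 powr (s * real n) * weight M n"
    by (simp add: weight_def sum_distrib_left split_def)
  also have "\<dots> \<le> 4 powr (s * real n) * (2 * \<beta> ^ n)" using weight_le[OF assms] by (intro mult_left_mono) auto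
  also have "\<dots> = 2 * (\<beta> * 4 powr s) ^ n"
    by (simp add: power_mult_distrib powr_powr[symmetric] powr_realpow)
  finally show ?thesis .
qed

text \<open>Borel-Cantelli covering: the sets of all levels \<open>n \<ge> N\<close> cover
  \<open>A\<close>, and the sum of their diameters to the power \<open>s\<close> is at most the tail
  of a geometric series of ratio \<open>r / 2 powr s < 1\<close>.\<close>

lemma hausdorff_measure_limsup_null:
  fixes V :: "nat \<Rightarrow> 'i \<Rightarrow> real set"
  assumes A: "\<And>x N. x \<in> A \<Longrightarrow> \<exists>n\<ge>N. \<exists>i\<in>K n. x \<in> V n i"
    and K: "\<And>n. finite (K n)" "\<And>n. real (card (K n)) \<le> C * r ^ n"
    and V: "\<And>n i. bounded (V n i)" "\<And>n i. diameter (V n i) \<le> (1/2) ^ n"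
    and s: "0 < s" and r: "0 \<le> r" "r < 2 powr s"
  shows "hausdorff_measure s A = 0"
proof -
  define q where "q = r / 2 powr s"
  have q: "0 \<le> q" "q < 1" using r by (auto simp: q_def)
  have C: "0 \<le> C" using K(2)[of 0] by simp
  have content: "hausdorff_content s \<delta> A \<le> ennreal \<epsilon>" if \<delta>: "0 < \<delta>" and \<epsilon>: "0 < \<epsilon>" for \<delta> \<epsilon> :: real
  proof -
    have summ: "summable (\<lambda>n. C * q ^ n)" using q by (intro summable_mult summable_geometric) auto
    obtain N1 where N1: "\<And>n. n \<ge> N1 \<Longrightarrow> norm (\<Sum>i. C * q ^ (i + n)) < \<epsilon>"
      using suminf_exist_split[OF \<epsilon> summ] by auto
    obtain N2 where N2: "(1/2) ^ N2 < \<delta>" using real_arch_pow_inv[OF \<delta>, of "1/2"] by auto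
    define N where "N = max N1 N2"
    have "(1/2::real) ^ N \<le> (1/2) ^ N2" by (intro power_decreasing) (auto simp: N_def)
    then have N: "(1/2) ^ N \<le> \<delta>" "norm (\<Sum>i. C * q ^ (i + N)) < \<epsilon>" using N1[of N] N2 by (linarith, simp add: N_def)
    have "\<exists>h. bij_betw h {0..<card (K n)} (K n)" for n by (rule ex_bij_betw_nat_finite[OF K(1)])
    then obtain h where h: "\<And>n. bij_betw (h n) {0..<card (K n)} (K n)" by metis
    \<comment> \<open>The content is defined by a single sequence of sets: levels and indices are
      merged by \<open>prod_decode\<close>, and surplus indices are filled with the empty
      set.\<close>
    define W where "W = (\<lambda>(m, j). if j < card (K (m + N)) then V (m + N) (h (m + N) j) else {})"
    define U where "U = (\<lambda>i. W (prod_decode i))"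
    have W_small: "bounded (W z)" "diameter (W z) \<le> (1/2) ^ (fst z + N)" for z
      using V by (auto simp: W_def split: prod.split)
    have "U \<in> {U. A \<subseteq> (\<Union>i. U i) \<and> (\<forall>i. bounded (U i) \<and> diameter (U i) \<le> \<delta>)}"
    proof (intro CollectI conjI allI subsetI)
      fix x assume "x \<in> A"
      then obtain n i where n: "n \<ge> N" "i \<in> K n" "x \<in> V n i" using A by blast
      have "i \<in> h n ` {0..<card (K n)}" using n(2) h[of n] by (simp add: bij_betw_def)
      then obtain j where j: "j < card (K n)" "h n j = i" by auto
      have "x \<in> W (n - N, j)" using n j by (auto simp: W_def)
      then have "x \<in> U (prod_encode (n - N, j))" by (simp add: U_def)
      then show "x \<in> (\<Union>i. U i)" by blast
    next
      fix i
      show "bounded (U i)" by (simp add: U_def W_small)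
      have "diameter (U i) \<le> (1/2) ^ (fst (prod_decode i) + N)" by (simp add: U_def W_small)
      also have "\<dots> \<le> (1/2) ^ N" by (intro power_decreasing) auto
      finally show "diameter (U i) \<le> \<delta>" using N(1) by linarith
    qed
    then have "hausdorff_content s \<delta> A \<le> (\<Sum>i. ennreal (diameter (U i) powr s))"
      unfolding hausdorff_content_def by (rule INF_lower)
    also have "\<dots> = (\<Sum>m. \<Sum>j. ennreal (diameter (W (m, j)) powr s))"
      unfolding U_def by (rule suminf_ennreal_2dimen) simp
    also have "\<dots> \<le> (\<Sum>m. ennreal (C * q ^ (m + N)))"
    proof (intro suminf_le allI summableI)
      fix m
      let ?n = "m + N"
      have "(\<Sum>j. ennreal (diameter (W (m, j)) powr s)) = (\<Sum>j<card (K ?n). ennreal (diameter (W (m, j)) powr s))"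
        by (rule suminf_finite) (auto simp: W_def)
      also have "\<dots> \<le> (\<Sum>j<card (K ?n). ennreal ((1 / 2 powr s) ^ ?n))"
      proof (intro sum_mono ennreal_leI)
        fix j
        have "diameter (W (m, j)) powr s \<le> ((1/2) ^ ?n) powr s"
          using W_small[of "(m, j)"] s by (intro powr_mono2) (auto intro: diameter_ge_0)
        also have "\<dots> = (1 / 2 powr s) ^ ?n"
          by (simp add: powr_divide power_divide powr_powr mult.commute flip: powr_realpow)
        finally show "diameter (W (m, j)) powr s \<le> (1 / 2 powr s) ^ ?n" .
      qed
      also have "\<dots> = ennreal (real (card (K ?n)) * (1 / 2 powr s) ^ ?n)"
        by (simp add: ennreal_of_nat_eq_real_of_nat ennreal_mult')
      also have "\<dots> \<le> ennreal (C * r ^ ?n * (1 / 2 powr s) ^ ?n)"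
        by (intro ennreal_leI mult_right_mono K) auto
      also have "C * r ^ ?n * (1 / 2 powr s) ^ ?n = C * q ^ ?n" by (simp add: q_def power_divide)
      finally show "(\<Sum>j. ennreal (diameter (W (m, j)) powr s)) \<le> ennreal (C * q ^ ?n)" .
    qed
    also have "\<dots> = ennreal (\<Sum>m. C * q ^ (m + N))"
      using q C summ by (intro suminf_ennreal2) (auto simp: summable_iff_shift)
    also have "\<dots> \<le> ennreal \<epsilon>" using N(2) by (intro ennreal_leI) auto
    finally show ?thesis .
  qed
  have "hausdorff_content s \<delta> A \<le> 0" if "0 < \<delta>" for \<delta>
    by (rule ennreal_le_epsilon) (simp add: content[OF that])
  then have "hausdorff_measure s A \<le> 0"
    unfolding hausdorff_measure_def by (intro SUP_least) simp
  then show ?thesis by simp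
qed

lemma hausdorff_dim_uncontrolled:
  "hausdorff_dim {c \<in> {0..<1}. \<not> (\<exists>\<Lambda>. controlled (1/2 - c) \<Lambda>)} = 0"
proof -
  let ?E = "{c \<in> {0..<1}. \<not> (\<exists>\<Lambda>. controlled (1/2 - c) \<Lambda>)}"
  have null: "hausdorff_measure s ?E = 0" if s: "0 < s" for s
  proof -
    \<comment> \<open>Budget of exponents: \<open>\<beta>\<close> contributes \<open>s / 4\<close>,
      and sparsity \<open>s / 4\<close> contributes \<open>4 powr (s / 4) = 2 powr (s / 2)\<close>;
      together \<open>3 * s / 4 < s\<close>.\<close>
    define \<beta> where "\<beta> = 2 powr (s / 4)"
    have \<beta>: "\<beta> > 1" using s by (simp add: \<beta>_def)
    obtain M0 where M0: "18 * \<beta> / (\<beta> - 1) < \<beta> ^ M0" using real_arch_pow[OF \<beta>] by blast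
    define M where "M = max M0 2"
    have "\<beta> ^ M0 \<le> \<beta> ^ M" using \<beta> by (intro power_increasing) (auto simp: M_def)
    then have "18 * \<beta> / (\<beta> - 1) \<le> \<beta> ^ M" using M0 by linarith
    then have M: "M \<ge> 2" "18 * \<beta> \<le> \<beta> ^ M * (\<beta> - 1)"
      using \<beta> by (simp_all add: M_def pos_divide_le_eq)
    define V where "V = (\<lambda>n (i::int). {c. \<lfloor>2 ^ n * (1/2 - c)\<rfloor> = i} :: real set)"
    have near: "\<bar>x - y\<bar> \<le> (1/2) ^ n" if "x \<in> V n i" "y \<in> V n i" for x y n i
    proof -
      have "\<lfloor>2 ^ n * (1/2 - x)\<rfloor> = \<lfloor>2 ^ n * (1/2 - y)\<rfloor>" using that by (simp add: V_def)
      then have "\<bar>2 ^ n * (1/2 - x) - 2 ^ n * (1/2 - y)\<bar> \<le> 1" by linarith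
      moreover have "2 ^ n * (1/2 - x) - 2 ^ n * (1/2 - y) = 2 ^ n * (y - x)" by (simp add: algebra_simps)
      ultimately have "2 ^ n * \<bar>x - y\<bar> \<le> 1" by (simp add: abs_mult abs_minus_commute)
      then show ?thesis by (simp add: power_divide pos_le_divide_eq mult.commute)
    qed
    show ?thesis
    proof (rule hausdorff_measure_limsup_null[where K = "sparse_cells M (s / 4)" and V = V and C = 2 and r = "\<beta> * 4 powr (s / 4)"])
      fix c :: real and N assume "c \<in> ?E"
      then have c: "0 \<le> c" "c < 1" "\<nexists>\<Lambda>. controlled (1/2 - c) \<Lambda>" by auto
      obtain n f where n: "n \<ge> N" "parse M (1/2 - c) n f" "real f \<le> s / 4 * real n"
        using ex_sparse_parse[OF c(3) _ M(1), of "s / 4" N] s by auto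
      have "(\<lfloor>2 ^ n * (1/2 - c)\<rfloor>, f) \<in> cells M n" using n c by (auto simp: cells_def)
      then have "\<lfloor>2 ^ n * (1/2 - c)\<rfloor> \<in> sparse_cells M (s / 4) n"
        using n(3) by (force simp: sparse_cells_def)
      moreover have "c \<in> V n \<lfloor>2 ^ n * (1/2 - c)\<rfloor>" by (simp add: V_def)
      ultimately show "\<exists>n\<ge>N. \<exists>i\<in>sparse_cells M (s / 4) n. c \<in> V n i" using n(1) by blast
    next
      show "bounded (V n i)" for n i
      proof (cases "V n i = {}")
        case False
        then obtain y where "y \<in> V n i" by auto
        then have "V n i \<subseteq> cball y ((1/2) ^ n)" using near by (auto simp: dist_real_def)
        then show ?thesis using bounded_cball bounded_subset by blast
      qed simp
      show "diameter (V n i) \<le> (1/2) ^ n" for n i using near by (intro diameter_le) auto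
      show "real (card (sparse_cells M (s / 4) n)) \<le> 2 * (\<beta> * 4 powr (s / 4)) ^ n" for n
        using \<beta> M by (intro card_sparse_cells) auto
      have "4 powr (s / 4) = 2 powr (s / 2)"
        using powr_powr[of 2 2 "s / 4"] by (simp add: mult.commute)
      then show "\<beta> * 4 powr (s / 4) < 2 powr s" using s by (simp add: \<beta>_def flip: powr_add)
    qed (use s \<beta> finite_sparse_cells in auto)
  qed
  let ?S = "{s. 0 \<le> s \<and> hausdorff_measure s ?E = 0}"
  show ?thesis
    unfolding hausdorff_dim_def
  proof (rule antisym)
    show "Inf ?S \<le> 0"
    proof (rule field_le_epsilon)
      fix e :: real assume "0 < e"
      then show "Inf ?S \<le> 0 + e" using null by (intro cInf_lower) (auto intro: bdd_belowI[of _ 0])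
    qed
    show "0 \<le> Inf ?S" using null[of 1] by (intro cInf_greatest) (auto intro!: exI[of _ "1::real"])
  qed
qed

section \<open>Almost every parameter\<close>

definition unif :: "real measure" where
  "unif = uniform_measure lborel {0..<1}"

lemma prob_space_unif: "prob_space unif"
  unfolding unif_def by (rule prob_space_uniform_measure) auto

lemma sets_unif [simp, measurable_cong]: "sets unif = sets borel"
  by (simp add: unif_def)

lemma space_unif [simp]: "space unif = UNIV"
  by (simp add: unif_def)

lemma AE_unif_iff: "(AE x in unif. P x) \<longleftrightarrow> (AE x in lborel. x \<in> {0..<1} \<longrightarrow> P x)"
  unfolding unif_def by (rule AE_uniform_measure) auto

lemma nn_integral_unif:
  assumes [measurable]: "g \<in> borel_measurable borel"
  shows "(\<integral>\<^sup>+ x. g x \<partial>unif) = (\<integral>\<^sup>+ x. g x * indicator {0..<1} x \<partial>lborel)"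
  unfolding unif_def by (subst nn_integral_uniform_measure) (auto simp: divide_ennreal_def)

lemma nn_integral_Ico_concat:
  fixes g :: "real \<Rightarrow> ennreal"
  assumes [measurable]: "g \<in> borel_measurable borel" and "a \<le> b" "b \<le> c"
  shows "(\<integral>\<^sup>+ x. g x * indicator {a..<c} x \<partial>lborel) =
    (\<integral>\<^sup>+ x. g x * indicator {a..<b} x \<partial>lborel) + (\<integral>\<^sup>+ x. g x * indicator {b..<c} x \<partial>lborel)"
  using assms(2,3) by (subst nn_integral_add[symmetric])
    (auto intro!: nn_integral_cong simp: indicator_def)

lemma nn_integral_periodic:
  fixes g :: "real \<Rightarrow> ennreal"
  assumes [measurable]: "g \<in> borel_measurable borel" and per: "\<And>x. g (frac x) = g x"
  shows "(\<integral>\<^sup>+ x. g x * indicator {a..<a + 1} x \<partial>lborel) = (\<integral>\<^sup>+ x. g x * indicator {0..<1} x \<partial>lborel)"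
proof -
  have shift: "(\<integral>\<^sup>+ x. g x * indicator {u + of_int m..<v + of_int m} x \<partial>lborel) =
      (\<integral>\<^sup>+ x. g x * indicator {u..<v} x \<partial>lborel)" for u v m
  proof -
    have "g (of_int m + x) = g x" for x
      using per[of "of_int m + x"] per[of x] by (metis Ints_of_int add.commute frac_add_int_right)
    then show ?thesis
      by (subst nn_integral_real_affine[where c = 1 and t = "of_int m"])
         (auto intro!: nn_integral_cong simp: indicator_def)
  qed
  define r where "r = frac a"
  have r: "0 \<le> r" "r \<le> 1" "a = r + of_int \<lfloor>a\<rfloor>" using frac_lt_1[of a] by (auto simp: r_def frac_def)
  have "(\<integral>\<^sup>+ x. g x * indicator {a..<a + 1} x \<partial>lborel) = (\<integral>\<^sup>+ x. g x * indicator {r..<r + 1} x \<partial>lborel)"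
    using shift[of r "\<lfloor>a\<rfloor>" "r + 1"] r(3) by (simp add: algebra_simps)
  also have "\<dots> = (\<integral>\<^sup>+ x. g x * indicator {r..<1} x \<partial>lborel) + (\<integral>\<^sup>+ x. g x * indicator {1..<r + 1} x \<partial>lborel)"
    using r by (intro nn_integral_Ico_concat) auto
  also have "(\<integral>\<^sup>+ x. g x * indicator {1..<r + 1} x \<partial>lborel) = (\<integral>\<^sup>+ x. g x * indicator {0..<r} x \<partial>lborel)"
    using shift[of 0 1 r] by simp
  also have "(\<integral>\<^sup>+ x. g x * indicator {r..<1} x \<partial>lborel) + \<dots> = (\<integral>\<^sup>+ x. g x * indicator {0..<1} x \<partial>lborel)"
    using r nn_integral_Ico_concat[of g 0 r 1] by (simp add: add.commute)
  finally show ?thesis .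
qed

lemma nn_integral_periodic_nat:
  fixes g :: "real \<Rightarrow> ennreal"
  assumes [measurable]: "g \<in> borel_measurable borel" and per: "\<And>x. g (frac x) = g x"
  shows "(\<integral>\<^sup>+ x. g x * indicator {a..<a + real q} x \<partial>lborel) = of_nat q * (\<integral>\<^sup>+ x. g x * indicator {0..<1} x \<partial>lborel)"
proof (induction q)
  case (Suc q)
  then show ?case
    using nn_integral_Ico_concat[of g a "a + real q" "a + real q + 1"] nn_integral_periodic[OF assms, of "a + real q"]
    by (simp add: algebra_simps)
qed simp

lemma nn_integral_affine_unif:
  fixes g :: "real \<Rightarrow> ennreal"
  assumes g [measurable]: "g \<in> borel_measurable borel" and per: "\<And>x. g (frac x) = g x" and q: "q \<ge> 1"
  shows "(\<integral>\<^sup>+ x. g (real q * x + a) \<partial>unif) = (\<integral>\<^sup>+ x. g x \<partial>unif)"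
proof -
  have "(\<integral>\<^sup>+ x. g x * indicator {a..<a + real q} x \<partial>lborel) =
      ennreal (real q) * (\<integral>\<^sup>+ x. g (real q * x + a) * indicator {0..<1} x \<partial>lborel)"
  proof (subst nn_integral_real_affine[where c = "real q" and t = a])
    have "indicator {a..<a + real q} (a + real q * x) = (indicator {0..<1} x :: ennreal)" for x
      using q by (auto simp: indicator_def mult_less_cancel_left1 zero_le_mult_iff)
    then show "ennreal \<bar>real q\<bar> * (\<integral>\<^sup>+ x. g (a + real q * x) * indicator {a..<a + real q} (a + real q * x) \<partial>lborel) =
        ennreal (real q) * (\<integral>\<^sup>+ x. g (real q * x + a) * indicator {0..<1} x \<partial>lborel)"
      by (simp add: add.commute)
  qed (use q in auto)
  then have "ennreal (real q) * (\<integral>\<^sup>+ x. g (real q * x + a) * indicator {0..<1} x \<partial>lborel) =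
      ennreal (real q) * (\<integral>\<^sup>+ x. g x * indicator {0..<1} x \<partial>lborel)"
    using nn_integral_periodic_nat[OF g per, of a q] by (simp add: ennreal_of_nat_eq_real_of_nat)
  then show ?thesis using q by (simp add: nn_integral_unif ennreal_mult_cancel_left)
qed

lemma frac_measurable [measurable]: "(frac :: real \<Rightarrow> real) \<in> borel_measurable borel"
  unfolding frac_def[abs_def] by measurable

lemma distr_affine_unif:
  assumes "q \<ge> 1"
  shows "distr unif borel (\<lambda>x. frac (real q * x + a)) = unif"
proof (rule measure_eqI)
  fix B assume "B \<in> sets (distr unif borel (\<lambda>x. frac (real q * x + a)))"
  then have [measurable]: "B \<in> sets borel" by simp
  have "emeasure (distr unif borel (\<lambda>x. frac (real q * x + a))) B = (\<integral>\<^sup>+ x. indicator B (frac (real q * x + a)) \<partial>unif)"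
    by (subst nn_integral_indicator[symmetric], simp, subst nn_integral_distr) auto
  also have "\<dots> = (\<integral>\<^sup>+ x. indicator B (frac x) \<partial>unif)"
    using assms by (intro nn_integral_affine_unif[where g = "\<lambda>x. indicator B (frac x)"]) auto
  also have "\<dots> = (\<integral>\<^sup>+ x. indicator B x \<partial>unif)"
    by (intro nn_integral_cong_AE) (auto simp: AE_unif_iff frac_eq)
  finally show "emeasure (distr unif borel (\<lambda>x. frac (real q * x + a))) B = emeasure unif B" by simp
qed simp

lemma integral_affine_unif:
  fixes f :: "real \<Rightarrow> real"
  assumes [measurable]: "f \<in> borel_measurable borel" and per: "\<And>x. f (frac x) = f x" and q: "q \<ge> 1"
  shows "(\<integral>x. f (real q * x + a) \<partial>unif) = (\<integral>x. f x \<partial>unif)"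
proof -
  have "(\<integral>x. f x \<partial>unif) = (\<integral>x. f x \<partial>distr unif borel (\<lambda>x. frac (real q * x + a)))"
    by (simp add: distr_affine_unif[OF q])
  also have "\<dots> = (\<integral>x. f (frac (real q * x + a)) \<partial>unif)" by (rule integral_distr) auto
  finally show ?thesis by (simp add: per)
qed

lemma integrable_affine_unif:
  fixes f :: "real \<Rightarrow> real"
  assumes [measurable]: "f \<in> borel_measurable borel" and per: "\<And>x. f (frac x) = f x" and q: "q \<ge> 1"
    and int: "integrable unif f"
  shows "integrable unif (\<lambda>x. f (real q * x + a))"
proof -
  have "integrable (distr unif borel (\<lambda>x. frac (real q * x + a))) f"
    by (simp add: distr_affine_unif[OF q] int)
  then have "integrable unif (\<lambda>x. f (frac (real q * x + a)))" by (subst (asm) integrable_distr_eq) auto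
  then show ?thesis by (simp add: per)
qed

section \<open>Product formula for sines\<close>

lemma prod_roots_of_unity:
  fixes w :: complex
  assumes q: "q > 0"
  shows "(\<Prod>i<q. w - cis (2 * pi * real i / real q)) = w ^ q - 1"
proof -
  define R where "R = {z :: complex. z ^ q = 1}"
  have R: "finite R" "card R = q" using card_roots_unity_eq[OF q] finite_roots_unity[of q] q by (auto simp: R_def)
  define P where "P = (\<Prod>z\<in>R. [:- z, 1:])"
  define Q where "Q = monom 1 q - (1 :: complex poly)"
  have degP: "degree P = q" unfolding P_def by (subst degree_prod_eq_sum_degree) (auto simp: R)
  have "P = Q"
  proof (rule poly_eqI_degree_lead_coeff[of P q Q R])
    have "lead_coeff P = 1" unfolding P_def lead_coeff_prod by simp
    then show "poly.coeff P q = poly.coeff Q q" using q by (simp add: degP Q_def)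
    show "degree Q \<le> q" unfolding Q_def by (intro degree_diff_le) (auto simp: degree_monom_le)
    show "poly P z = poly Q z" if "z \<in> R" for z
    proof -
      have "poly P z = 0" using that R(1) unfolding P_def poly_prod by (intro prod_zero) auto
      then show ?thesis using that by (simp add: Q_def R_def poly_monom)
    qed
  qed (simp_all add: degP R)
  then have "poly P w = poly Q w" by simp
  then have "(\<Prod>z\<in>R. w - z) = w ^ q - 1" by (simp add: P_def Q_def poly_prod poly_monom)
  moreover have "(\<Prod>i<q. w - cis (2 * pi * real i / real q)) = (\<Prod>z\<in>R. w - z)"
    using Complex.bij_betw_roots_unity[OF q] unfolding R_def by (rule prod.reindex_bij_betw)
  ultimately show ?thesis by simp
qed

lemma norm_cis_diff: "norm (cis (2 * pi * x) - cis (2 * pi * y)) = 2 * sd (x - y)"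
proof -
  have "cis (2 * pi * x) - cis (2 * pi * y) = cis (2 * pi * y) * (cis (2 * pi * (x - y)) - 1)"
    by (simp add: right_diff_distrib cis_mult)
  then have "norm (cis (2 * pi * x) - cis (2 * pi * y)) = norm (cis (2 * pi * (x - y)) - 1)"
    by (simp add: norm_mult)
  also have "\<dots> = 2 * sd (x - y)"
    using dist_exp_i_1[of "2 * pi * (x - y)"] by (simp add: cis_conv_exp sd_def)
  finally show ?thesis .
qed

text \<open>Modulus of the factorization of \<open>w ^ q - 1\<close> over the roots of unity at
  \<open>w = cis (2 * pi * - x)\<close>, a chord of the unit circle being
  \<open>2 * sd\<close>.\<close>

lemma prod_sd:
  assumes q: "q > 0"
  shows "(\<Prod>i<q. 2 * sd (x + real i / real q)) = 2 * sd (real q * x)"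
proof -
  have "(\<Prod>i<q. 2 * sd (x + real i / real q)) = (\<Prod>i<q. norm (cis (2 * pi * - x) - cis (2 * pi * (real i / real q))))"
    unfolding norm_cis_diff by (intro prod.cong refl) (metis diff_conv_add_uminus minus_add_distrib sd_minus)
  also have "\<dots> = norm (\<Prod>i<q. cis (2 * pi * - x) - cis (2 * pi * real i / real q))"
    by (simp add: prod_norm)
  also have "\<dots> = norm (cis (2 * pi * - x) ^ q - 1)" by (simp only: prod_roots_of_unity[OF q])
  also have "cis (2 * pi * - x) ^ q = cis (2 * pi * (- (real q * x)))" unfolding Complex.DeMoivre by (rule arg_cong[where f = cis]) simp
  also have "norm (cis (2 * pi * (- (real q * x))) - 1) = 2 * sd (real q * x)"
    using norm_cis_diff[of "- (real q * x)" 0] by simp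
  finally show ?thesis .
qed

text \<open>Away from the integers this is ln |2 sin pi x|. With the factor 2 inside, the product
  formula becomes an exact sum of \<open>psi\<close> over the shifts by i/q, with no constant
  term.\<close>

definition psi :: "real \<Rightarrow> real" where
  "psi x = ln 2 - phi x"

lemma psi_measurable [measurable]: "psi \<in> borel_measurable borel"
  unfolding psi_def by measurable

lemma phi_cong_Ints: "x - y \<in> \<int> \<Longrightarrow> phi x = phi y"
  using sd_cong_Ints[of x y] by (simp add: phi_def)

lemma psi_cong_Ints: "x - y \<in> \<int> \<Longrightarrow> psi x = psi y"
  using phi_cong_Ints[of x y] by (simp add: psi_def)

lemma psi_mult_frac: "psi (real q * frac x + a) = psi (real q * x + a)"
proof (rule psi_cong_Ints)
  have "real q * frac x + a - (real q * x + a) = - (of_nat q * of_int \<lfloor>x\<rfloor>)"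
    by (simp add: frac_def algebra_simps)
  then show "real q * frac x + a - (real q * x + a) \<in> \<int>" by simp
qed

lemma psi_frac: "psi (frac x) = psi x"
  using psi_mult_frac[of 1 x 0] by simp

lemma psi_mult_nat:
  assumes q: "q > 0" and nz: "sd (real q * x) \<noteq> 0"
  shows "psi (real q * x) = (\<Sum>i<q. psi (x + real i / real q))"
proof -
  have psi_ln: "psi y = ln (2 * sd y)" if "sd y \<noteq> 0" for y
    using that sd_nonneg[of y] by (simp add: psi_def phi_def ln_mult_pos less_le)
  have pos: "sd (x + real i / real q) \<noteq> 0" if "i < q" for i
  proof
    assume "sd (x + real i / real q) = 0"
    then have "(\<Prod>i<q. 2 * sd (x + real i / real q)) = 0" using that by (intro prod_zero) auto
    then show False using prod_sd[OF q, of x] nz by simp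
  qed
  have "psi (real q * x) = ln (\<Prod>i<q. 2 * sd (x + real i / real q))" using nz by (simp add: psi_ln prod_sd[OF q])
  also have "\<dots> = (\<Sum>i<q. ln (2 * sd (x + real i / real q)))"
    using pos by (intro ln_prod) (auto simp: less_le)
  also have "\<dots> = (\<Sum>i<q. psi (x + real i / real q))" using pos by (intro sum.cong) (auto simp: psi_ln)
  finally show ?thesis .
qed

section \<open>Square integrability of the logarithm\<close>

lemma AE_sd_affine_nonzero:
  assumes "q \<noteq> 0"
  shows "AE x in lborel. sd (q * x + a) \<noteq> 0"
proof -
  have "{x. sd (q * x + a) = 0} \<subseteq> range (\<lambda>i::int. (of_int i - a) / q)"
  proof
    fix x assume "x \<in> {x. sd (q * x + a) = 0}"
    then obtain i :: int where "q * x + a = of_int i" by (auto simp: sd_eq_0_iff Ints_def)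
    then have "x = (of_int i - a) / q" using assms by (simp add: field_simps)
    then show "x \<in> range (\<lambda>i::int. (of_int i - a) / q)" by blast
  qed
  then have "countable {x. sd (q * x + a) = 0}" by (rule countable_subset) simp
  then have "{x. sd (q * x + a) = 0} \<in> null_sets lborel" by (rule countable_imp_null_set_lborel)
  then show ?thesis by (rule AE_I') auto
qed

text \<open>The inequality ln u <= u at u = y^(-1/4) gives (ln y)^2 <= 16 y^(-1/2), which is
  integrable at 0; \<open>h x\<close> and \<open>h (1 - x)\<close> treat the singularities at the
  two ends of [0,1].\<close>

lemma phi_square_integrable: "integrable unif (\<lambda>x. (phi x)\<^sup>2)"
proof -
  interpret prob_space unif by (rule prob_space_unif)
  define h where "h = (\<lambda>x::real. if x \<in> {0..1} then x powr (- (1/2)) else 0)"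
  have [measurable]: "h \<in> borel_measurable borel" unfolding h_def by measurable
  have "(h has_integral 2) UNIV"
    using has_integral_powr_from_0[of "- (1/2)" 1] unfolding h_def has_integral_restrict_UNIV by simp
  then have h1: "(\<integral>\<^sup>+ x. ennreal (h x) \<partial>lborel) = 2"
    by (subst nn_integral_has_integral_lborel[of h 2]) (auto simp: h_def)
  then have h2: "(\<integral>\<^sup>+ x. ennreal (h (1 - x)) \<partial>lborel) = 2"
    using nn_integral_real_affine[of "\<lambda>x. ennreal (h x)" "- 1" 1] by simp
  have aux: "(phi x)\<^sup>2 \<le> 16 * y powr (- (1/2))" if y: "0 < y" "y \<le> sd x" for x y
  proof -
    define z where "z = y powr (1/4)"
    have z: "0 < z" using y by (simp add: z_def)
    have "phi x \<le> - ln y" using y by (simp add: phi_def)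
    also have "\<dots> = 4 * ln (1 / z)" using y by (simp add: z_def ln_powr ln_div)
    also have "\<dots> \<le> 4 * (1 / z)" using z ln_bound[of "1 / z"] by simp
    finally have "(phi x)\<^sup>2 \<le> (4 * (1 / z))\<^sup>2" by (intro power_mono) auto
    also have "\<dots> = 16 * y powr (- (1/2))"
      using y by (simp add: z_def power2_eq_square powr_minus_divide powr_add[symmetric])
    finally show ?thesis .
  qed
  have "(\<integral>\<^sup>+ x. ennreal ((phi x)\<^sup>2) \<partial>unif) = (\<integral>\<^sup>+ x. ennreal ((phi x)\<^sup>2) * indicator {0..<1} x \<partial>lborel)"
    by (rule nn_integral_unif) measurable
  also have "\<dots> \<le> (\<integral>\<^sup>+ x. 16 * ennreal (h x) + 16 * ennreal (h (1 - x)) \<partial>lborel)"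
  proof (rule nn_integral_mono_AE)
    have "AE x in lborel. sd (1 * x + 0) \<noteq> 0" by (rule AE_sd_affine_nonzero) simp
    then show "AE x in lborel. ennreal ((phi x)\<^sup>2) * indicator {0..<1} x \<le> 16 * ennreal (h x) + 16 * ennreal (h (1 - x))"
    proof eventually_elim
      case (elim x)
      show ?case
      proof (cases "x \<in> {0..<1}")
        case True
        with elim have x: "0 < x" "x < 1" by (auto simp: less_le sd_def)
        have "(phi x)\<^sup>2 \<le> 16 * h x + 16 * h (1 - x)"
        proof (cases "x \<le> 1/2")
          case True
          then have "(phi x)\<^sup>2 \<le> 16 * h x" using x sd_ge_linear[of x] aux[of x x] by (simp add: h_def)
          then show ?thesis using x by (simp add: h_def add_increasing2)
        next
          case False
          have "sd (1 - x) = sd (- x)" by (rule sd_cong_Ints) simp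
          then have "(phi x)\<^sup>2 \<le> 16 * h (1 - x)" using x False sd_ge_linear[of "1 - x"] aux[of "1 - x" x] by (simp add: h_def)
          then show ?thesis using x by (simp add: h_def add_increasing)
        qed
        then have "ennreal ((phi x)\<^sup>2) \<le> ennreal (16 * h x + 16 * h (1 - x))" by (rule ennreal_leI)
        then show ?thesis using True by (simp add: h_def ennreal_mult)
      qed simp
    qed
  qed
  also have "\<dots> = 16 * 2 + 16 * 2"
    by (subst nn_integral_add) (auto simp: nn_integral_cmult h1 h2)
  also have "\<dots> < \<infinity>" by (simp add: ennreal_mult_less_top)
  finally show ?thesis by (intro integrableI_nonneg) auto
qed

lemma psi_square_integrable: "integrable unif (\<lambda>x. (psi x)\<^sup>2)"
proof -
  interpret prob_space unif by (rule prob_space_unif)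
  show ?thesis
  proof (rule Bochner_Integration.integrable_bound)
    show "integrable unif (\<lambda>x. 2 * (ln 2)\<^sup>2 + 2 * (phi x)\<^sup>2)"
      using phi_square_integrable by auto
    show "AE x in unif. norm ((psi x)\<^sup>2) \<le> norm (2 * (ln 2)\<^sup>2 + 2 * (phi x)\<^sup>2)"
    proof (rule AE_I2)
      fix x
      have "0 \<le> ln 2 * phi x" by simp
      then have "(psi x)\<^sup>2 \<le> 2 * (ln 2)\<^sup>2 + 2 * (phi x)\<^sup>2"
        unfolding psi_def power2_diff using zero_le_power2[of "ln (2::real)"] zero_le_power2[of "phi x"] by linarith
      then show "norm ((psi x)\<^sup>2) \<le> norm (2 * (ln 2)\<^sup>2 + 2 * (phi x)\<^sup>2)" by simp
    qed
  qed measurable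
qed

section \<open>Correlations of integer dilates\<close>

definition psi_var :: real where
  "psi_var = (\<integral>x. (psi x)\<^sup>2 \<partial>unif)"

lemma psi_var_nonneg: "0 \<le> psi_var"
  unfolding psi_var_def by (rule integral_nonneg_AE) simp

lemma psi_prod_integrable:
  assumes "p \<ge> 1" "q \<ge> 1"
  shows "integrable unif (\<lambda>x. psi (real p * x + a) * psi (real q * x + c))"
proof (rule Bochner_Integration.integrable_bound)
  show "integrable unif (\<lambda>x. (psi (real p * x + a))\<^sup>2 + (psi (real q * x + c))\<^sup>2)"
    using assms psi_square_integrable psi_frac
    by (intro Bochner_Integration.integrable_add integrable_affine_unif[where f = "\<lambda>x. (psi x)\<^sup>2"]) auto
  show "AE x in unif. norm (psi (real p * x + a) * psi (real q * x + c))
      \<le> norm ((psi (real p * x + a))\<^sup>2 + (psi (real q * x + c))\<^sup>2)"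
  proof (rule AE_I2)
    fix x
    have "2 * \<bar>u * v\<bar> \<le> u\<^sup>2 + v\<^sup>2" for u v :: real
      using zero_le_power2[of "\<bar>u\<bar> - \<bar>v\<bar>"] by (simp add: power2_diff abs_mult)
    from this[of "psi (real p * x + a)" "psi (real q * x + c)"]
    show "norm (psi (real p * x + a) * psi (real q * x + c))
      \<le> norm ((psi (real p * x + a))\<^sup>2 + (psi (real q * x + c))\<^sup>2)" by simp
  qed
qed measurable

text \<open>The factor \<open>1/p\<close> comes from averaging over the shifts by \<open>i/p\<close>: they fix \<open>psi (p x)\<close>, while
  \<open>q\<close> being a unit modulo \<open>p\<close>, they turn \<open>psi (q x)\<close> into \<open>psi (p q x)\<close> by the product
  formula for sines.\<close>
lemma psi_correlation_reduce:
  assumes p: "p \<ge> 1" and q: "q \<ge> 1" and cop: "coprime p q"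
  shows "real p * (\<integral>x. psi (real p * x) * psi (real q * x) \<partial>unif) = (\<integral>x. psi x * psi (real q * x) \<partial>unif)"
proof -
  define f where "f = (\<lambda>x. psi (real p * x) * psi (real q * x))"
  have [measurable]: "f \<in> borel_measurable borel" unfolding f_def by measurable
  have f_frac: "f (frac x) = f x" for x
    using psi_mult_frac[of p x 0] psi_mult_frac[of q x 0] by (simp add: f_def)
  have f_shift: "f (1 * x + real i / real p) = psi (real p * x) * psi (real q * x + real q * real i / real p)" for x i
  proof -
    have "psi (real p * (x + real i / real p)) = psi (real p * x)"
      using p by (intro psi_cong_Ints) (simp add: algebra_simps)
    then show ?thesis by (simp add: f_def algebra_simps)
  qed
  have sum_shift: "(\<Sum>i<p. psi (y + real q * real i / real p)) = (\<Sum>i<p. psi (y + real i / real p))" for y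
  proof -
    have inj: "inj_on (\<lambda>i. q * i mod p) {..<p}"
    proof (rule linorder_inj_onI')
      fix i j assume ij: "i \<in> {..<p}" "j \<in> {..<p}" "i < j"
      show "q * i mod p \<noteq> q * j mod p"
      proof
        assume "q * i mod p = q * j mod p"
        then have "p dvd q * j - q * i" using ij mod_eq_dvd_iff_nat[of "q * i" "q * j" p] by simp
        then have "p dvd q * (j - i)" by (simp add: diff_mult_distrib2)
        then have "p dvd j - i" using cop by (simp add: coprime_dvd_mult_right_iff)
        then show False using ij by (auto dest: dvd_imp_le)
      qed
    qed
    have "(\<lambda>i. q * i mod p) ` {..<p} = {..<p}"
      using p by (intro endo_inj_surj inj) auto
    then have bij: "bij_betw (\<lambda>i. q * i mod p) {..<p} {..<p}" using inj by (simp add: bij_betw_def)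
    have "(\<Sum>i<p. psi (y + real i / real p)) = (\<Sum>i<p. psi (y + real (q * i mod p) / real p))"
      by (rule sum.reindex_bij_betw[OF bij, symmetric])
    also have "\<dots> = (\<Sum>i<p. psi (y + real q * real i / real p))"
    proof (intro sum.cong refl psi_cong_Ints)
      fix i
      have "real (q * i) = real (q * i mod p) + real p * real (q * i div p)"
        by (metis mod_mult_div_eq of_nat_add of_nat_mult)
      then have "y + real (q * i mod p) / real p - (y + real q * real i / real p) = - real (q * i div p)"
        using p by (simp add: field_simps)
      then show "y + real (q * i mod p) / real p - (y + real q * real i / real p) \<in> \<int>" by simp
    qed
    finally show ?thesis by simp
  qed
  have "real p * (\<integral>x. f x \<partial>unif) = (\<Sum>i<p. (\<integral>x. f (real 1 * x + real i / real p) \<partial>unif))"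
    using integral_affine_unif[of f 1] f_frac by simp
  also have "\<dots> = (\<integral>x. (\<Sum>i<p. f (real 1 * x + real i / real p)) \<partial>unif)"
  proof (rule Bochner_Integration.integral_sum[symmetric])
    fix i
    have "integrable unif f" unfolding f_def using psi_prod_integrable[OF p q, of 0 0] by simp
    then show "integrable unif (\<lambda>x. f (real 1 * x + real i / real p))"
      using f_frac by (intro integrable_affine_unif) auto
  qed
  also have "\<dots> = (\<integral>x. psi (real p * x) * psi (real q * (real p * x)) \<partial>unif)"
  proof (rule integral_cong_AE)
    have "AE x in lborel. sd (real (p * q) * x + 0) \<noteq> 0" using p q by (intro AE_sd_affine_nonzero) auto
    then show "AE x in unif. (\<Sum>i<p. f (real 1 * x + real i / real p)) = psi (real p * x) * psi (real q * (real p * x))"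
      unfolding AE_unif_iff
    proof eventually_elim
      case (elim x)
      have "(\<Sum>i<p. f (real 1 * x + real i / real p)) = psi (real p * x) * (\<Sum>i<p. psi (real q * x + real i / real p))"
        unfolding sum_shift[symmetric] using f_shift[of x] by (simp add: sum_distrib_left)
      also have "(\<Sum>i<p. psi (real q * x + real i / real p)) = psi (real p * (real q * x))"
        using elim p by (intro psi_mult_nat[symmetric]) (auto simp: mult_ac)
      finally show ?case by (simp add: mult_ac)
    qed
  qed measurable
  also have "\<dots> = (\<integral>x. psi x * psi (real q * x) \<partial>unif)"
    using integral_affine_unif[of "\<lambda>x. psi x * psi (real q * x)" p 0] p psi_frac psi_mult_frac[of q _ 0] by simp
  finally show ?thesis by (simp add: f_def)
qed

text \<open>Dividing out the gcd \<open>g\<close> gives the exact value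
  \<open>psi_var / (p' * q')\<close>, that is \<open>psi_var * g ^ 2 / (p * q)\<close>. The cruder
  bound from \<open>g \<le> p\<close> is chosen because for \<open>p = 2 ^ j - 1\<close> and
  \<open>q = 2 ^ n - 1\<close> it decays geometrically in \<open>n - j\<close>, whatever the common
  factors.\<close>

lemma psi_correlation_le:
  assumes p: "p \<ge> 1" and pq: "p \<le> q"
  shows "(\<integral>x. psi (real p * x) * psi (real q * x) \<partial>unif) \<le> psi_var * (real p / real q)"
proof -
  define g where "g = gcd p q"
  have g: "g \<ge> 1" "g \<le> p" using p by (auto simp: g_def Suc_le_eq intro: dvd_imp_le)
  define p' q' where "p' = p div g" and "q' = q div g"
  have eq: "p = g * p'" "q = g * q'" by (auto simp: p'_def q'_def g_def)
  have pos: "p' \<ge> 1" "q' \<ge> 1" using eq p pq by (auto simp: Suc_le_eq intro!: gr0I)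
  have cop: "coprime p' q'" unfolding p'_def q'_def g_def using p by (intro div_gcd_coprime) auto
  have q': "real q' * (\<integral>x. psi x * psi (real q' * x) \<partial>unif) = psi_var"
    using psi_correlation_reduce[of q' 1] pos by (simp add: psi_var_def power2_eq_square mult.commute)
  have "(\<integral>x. psi (real p * x) * psi (real q * x) \<partial>unif) = (\<integral>x. psi (real p' * x) * psi (real q' * x) \<partial>unif)"
    using integral_affine_unif[of "\<lambda>x. psi (real p' * x) * psi (real q' * x)" g 0] g(1)
      psi_mult_frac[of p' _ 0] psi_mult_frac[of q' _ 0] by (simp add: eq mult_ac)
  also have "\<dots> = psi_var / (real p' * real q')"
  proof -
    have "real q' * (real p' * (\<integral>x. psi (real p' * x) * psi (real q' * x) \<partial>unif)) = psi_var"
      unfolding psi_correlation_reduce[OF pos cop] by (rule q')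
    then show ?thesis using pos by (simp add: eq_divide_eq mult_ac)
  qed
  also have "\<dots> \<le> psi_var * (real p / real q)"
  proof -
    have "real p / real q = real p' / real q'" using g(1) by (simp add: eq)
    moreover have "1 / (real p' * real q') \<le> real p' / real q'"
      using pos mult_mono[of 1 "real p'" 1 "real p'"] by (simp add: field_simps)
    ultimately have "psi_var * (1 / (real p' * real q')) \<le> psi_var * (real p / real q)"
      using psi_var_nonneg by (intro mult_left_mono) simp_all
    then show ?thesis by simp
  qed
  finally show ?thesis .
qed

section \<open>Second moments and almost sure averages\<close>

definition psi_sum :: "nat \<Rightarrow> real \<Rightarrow> real" where
  "psi_sum n x = (\<Sum>k=1..n. psi (2 ^ k * x - x))"

lemma psi_sum_measurable [measurable]: "psi_sum n \<in> borel_measurable borel"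
  unfolding psi_sum_def by measurable

text \<open>Passing from \<open>n\<close> to \<open>Suc n\<close> adds twice the cross correlations,
  a geometric sum of at most \<open>psi_var\<close>, and one diagonal term: hence the factor
  3.\<close>

lemma psi_sum_second_moment:
  "integrable unif (\<lambda>x. (psi_sum n x)\<^sup>2) \<and> (\<integral>x. (psi_sum n x)\<^sup>2 \<partial>unif) \<le> 3 * psi_var * real n"
proof (induction n)
  case 0
  show ?case by (simp add: psi_sum_def)
next
  case (Suc n)
  define Q where "Q = (\<lambda>k. 2 ^ k - 1 :: nat)"
  have Q: "psi (2 ^ k * x - x) = psi (real (Q k) * x)" for k x
    by (simp add: Q_def of_nat_diff left_diff_distrib)
  have Q1: "Q k \<ge> 1" if "k \<ge> 1" for k
    using that power_increasing[of 1 k "2::nat"] by (simp add: Q_def)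
  have int: "integrable unif (\<lambda>x. psi (2 ^ j * x - x) * psi (2 ^ k * x - x))" if "j \<ge> 1" "k \<ge> 1" for j k
    unfolding Q using psi_prod_integrable[OF Q1 Q1, OF that, of 0 0] by simp
  have cor: "(\<integral>x. psi (2 ^ j * x - x) * psi (2 ^ Suc n * x - x) \<partial>unif) \<le> psi_var * (2 ^ j / 2 ^ Suc n)"
    if j: "1 \<le> j" "j \<le> Suc n" for j
  proof -
    have "(\<integral>x. psi (2 ^ j * x - x) * psi (2 ^ Suc n * x - x) \<partial>unif) \<le> psi_var * (real (Q j) / real (Q (Suc n)))"
    proof -
      have "(2::nat) ^ j \<le> 2 ^ Suc n" using j by (intro power_increasing) auto
      then have "Q j \<le> Q (Suc n)" unfolding Q_def by (rule diff_le_mono)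
      then show ?thesis unfolding Q using j by (intro psi_correlation_le Q1)
    qed
    also have "\<dots> \<le> psi_var * (2 ^ j / 2 ^ Suc n)"
    proof (intro mult_left_mono psi_var_nonneg)
      have "(2::real) ^ j \<le> 2 ^ Suc n" using j by (intro power_increasing) auto
      then have "real (Q j) * 2 ^ Suc n \<le> 2 ^ j * real (Q (Suc n))"
        by (simp add: Q_def of_nat_diff algebra_simps)
      then show "real (Q j) / real (Q (Suc n)) \<le> 2 ^ j / 2 ^ Suc n"
        using Q1[of "Suc n"] by (simp add: divide_simps mult.commute)
    qed
    finally show ?thesis .
  qed
  have expand: "(psi_sum (Suc n) x)\<^sup>2 = (psi_sum n x)\<^sup>2 + 2 * (\<Sum>j=1..n. psi (2 ^ j * x - x) * psi (2 ^ Suc n * x - x))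
      + psi (2 ^ Suc n * x - x) * psi (2 ^ Suc n * x - x)" for x
  proof -
    have "psi_sum (Suc n) x = psi_sum n x + psi (2 ^ Suc n * x - x)" by (simp add: psi_sum_def)
    moreover have "(\<Sum>j=1..n. psi (2 ^ j * x - x) * psi (2 ^ Suc n * x - x)) = psi_sum n x * psi (2 ^ Suc n * x - x)"
      by (simp only: psi_sum_def sum_distrib_right)
    ultimately show ?thesis by (simp add: power2_eq_square algebra_simps del: power_Suc)
  qed
  have int2: "integrable unif (\<lambda>x. \<Sum>j=1..n. psi (2 ^ j * x - x) * psi (2 ^ Suc n * x - x))"
    by (intro Bochner_Integration.integrable_sum int) auto
  have int3: "integrable unif (\<lambda>x. psi (2 ^ Suc n * x - x) * psi (2 ^ Suc n * x - x))" by (rule int) auto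
  have "(\<integral>x. (psi_sum (Suc n) x)\<^sup>2 \<partial>unif) = (\<integral>x. (psi_sum n x)\<^sup>2 \<partial>unif)
      + 2 * (\<integral>x. (\<Sum>j=1..n. psi (2 ^ j * x - x) * psi (2 ^ Suc n * x - x)) \<partial>unif)
      + (\<integral>x. psi (2 ^ Suc n * x - x) * psi (2 ^ Suc n * x - x) \<partial>unif)"
    unfolding expand using Suc int2 int3
    by (subst Bochner_Integration.integral_add, simp, simp, subst Bochner_Integration.integral_add) auto
  also have "(\<integral>x. (\<Sum>j=1..n. psi (2 ^ j * x - x) * psi (2 ^ Suc n * x - x)) \<partial>unif)
      = (\<Sum>j=1..n. (\<integral>x. psi (2 ^ j * x - x) * psi (2 ^ Suc n * x - x) \<partial>unif))"
    by (rule Bochner_Integration.integral_sum) (auto intro!: int simp del: power_Suc)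
  also have "\<dots> \<le> (\<Sum>j=1..n. psi_var * (2 ^ j / 2 ^ Suc n))" by (intro sum_mono cor) auto
  also have "\<dots> = psi_var * ((\<Sum>j=1..n. 2 ^ j) / 2 ^ Suc n)" by (simp add: sum_distrib_left sum_divide_distrib)
  also have "\<dots> \<le> psi_var * 1"
  proof (intro mult_left_mono psi_var_nonneg)
    have "(\<Sum>j=1..n. 2 ^ j) \<le> (2::real) ^ Suc n" by (induction n) auto
    then show "(\<Sum>j=1..n. 2 ^ j) / (2::real) ^ Suc n \<le> 1" by simp
  qed
  also have "(\<integral>x. psi (2 ^ Suc n * x - x) * psi (2 ^ Suc n * x - x) \<partial>unif) \<le> psi_var"
    using cor[of "Suc n"] by simp
  finally have "(\<integral>x. (psi_sum (Suc n) x)\<^sup>2 \<partial>unif) \<le> 3 * psi_var * real (Suc n)"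
    using Suc by (simp add: algebra_simps)
  moreover have "integrable unif (\<lambda>x. (psi_sum (Suc n) x)\<^sup>2)"
    unfolding expand using Suc int2 int3 by (intro Bochner_Integration.integrable_add integrable_mult_right) auto
  ultimately show ?case by blast
qed

text \<open>The averages have second moments of order 1/n, a bound that is summable along squares
  but not along all n. Summable expectations give almost sure summability, hence convergence to
  0.\<close>

lemma AE_psi_sum_squares:
  "AE x in unif. (\<lambda>m. psi_sum ((Suc m)\<^sup>2) x / real ((Suc m)\<^sup>2)) \<longlonglongrightarrow> 0"
proof -
  define X where "X = (\<lambda>m x. (psi_sum ((Suc m)\<^sup>2) x / real ((Suc m)\<^sup>2))\<^sup>2)"
  have [measurable]: "X m \<in> borel_measurable borel" for m unfolding X_def by measurable
  have EX: "(\<integral>\<^sup>+ x. ennreal (X m x) \<partial>unif) \<le> ennreal (3 * psi_var * inverse (real (Suc m) ^ 2))" for m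
  proof -
    let ?n = "(Suc m)\<^sup>2"
    have sm: "integrable unif (\<lambda>x. (psi_sum ?n x)\<^sup>2)" "(\<integral>x. (psi_sum ?n x)\<^sup>2 \<partial>unif) \<le> 3 * psi_var * real ?n"
      using psi_sum_second_moment[of ?n] by auto
    have "integrable unif (X m)" unfolding X_def power_divide using sm by (intro integrable_divide_zero) auto
    then have "(\<integral>\<^sup>+ x. ennreal (X m x) \<partial>unif) = ennreal (\<integral>x. X m x \<partial>unif)"
      by (intro nn_integral_eq_integral) (auto simp: X_def)
    also have "(\<integral>x. X m x \<partial>unif) = (\<integral>x. (psi_sum ?n x)\<^sup>2 \<partial>unif) / (real ?n)\<^sup>2"
      unfolding X_def power_divide by simp
    also have "\<dots> \<le> 3 * psi_var * real ?n / (real ?n)\<^sup>2" using sm by (intro divide_right_mono) auto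
    also have "\<dots> = 3 * psi_var * inverse (real ?n)"
    proof -
      have "3 * psi_var * r / r\<^sup>2 = 3 * psi_var * inverse r" if "r \<noteq> 0" for r :: real
        using that by (simp add: power2_eq_square divide_inverse)
      then show ?thesis by (simp del: of_nat_power of_nat_Suc)
    qed
    finally show ?thesis by (simp add: ennreal_leI)
  qed
  have "(\<integral>\<^sup>+ x. (\<Sum>m. ennreal (X m x)) \<partial>unif) = (\<Sum>m. (\<integral>\<^sup>+ x. ennreal (X m x) \<partial>unif))"
    by (rule nn_integral_suminf) measurable
  also have "\<dots> \<le> (\<Sum>m. ennreal (3 * psi_var * inverse (real (Suc m) ^ 2)))"
    by (intro suminf_le allI summableI EX)
  also have "\<dots> = ennreal (\<Sum>m. 3 * psi_var * inverse (real (Suc m) ^ 2))"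
  proof (rule suminf_ennreal2)
    have "summable (\<lambda>m. inverse (real m ^ 2))" by (rule inverse_power_summable) simp
    then have "summable (\<lambda>m. inverse (real (Suc m) ^ 2))" by (subst summable_Suc_iff)
    then show "summable (\<lambda>m. 3 * psi_var * inverse (real (Suc m) ^ 2))" by (rule summable_mult)
  qed (use psi_var_nonneg in auto)
  finally have "(\<integral>\<^sup>+ x. (\<Sum>m. ennreal (X m x)) \<partial>unif) \<noteq> \<infinity>" by (auto simp: top_unique)
  then have "AE x in unif. (\<Sum>m. ennreal (X m x)) \<noteq> \<infinity>" by (intro nn_integral_PInf_AE) measurable
  then show ?thesis
  proof eventually_elim
    case (elim x)
    then have "summable (\<lambda>m. X m x)" by (intro summable_suminf_not_top) (auto simp: X_def)
    then have "(\<lambda>m. X m x) \<longlonglongrightarrow> 0" by (rule summable_LIMSEQ_zero)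
    then have "(\<lambda>m. sqrt (X m x)) \<longlonglongrightarrow> sqrt 0" by (rule tendsto_real_sqrt)
    then have "(\<lambda>m. \<bar>psi_sum ((Suc m)\<^sup>2) x / real ((Suc m)\<^sup>2)\<bar>) \<longlonglongrightarrow> 0"
      by (simp only: X_def real_sqrt_abs real_sqrt_zero)
    then show ?case by (rule tendsto_rabs_zero_cancel)
  qed
qed

text \<open>Between consecutive squares a monotone \<open>R\<close> is pinched, and m^2 / (m+1)^2
  tends to 1. It is meant for \<open>ret_sum\<close>; the sums of \<open>psi\<close> have terms of
  both signs and are not monotone.\<close>

lemma LIMSEQ_average_from_squares:
  fixes R :: "nat \<Rightarrow> real"
  assumes mono: "\<And>m n. m \<le> n \<Longrightarrow> R m \<le> R n" and nonneg: "\<And>n. 0 \<le> R n"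
    and lim: "(\<lambda>m. R ((Suc m)\<^sup>2) / real ((Suc m)\<^sup>2)) \<longlonglongrightarrow> L"
  shows "(\<lambda>n. R n / real n) \<longlonglongrightarrow> L"
proof -
  define Y where "Y = (\<lambda>m. R (m\<^sup>2) / real (m\<^sup>2))"
  have Y1: "(\<lambda>m. Y (Suc m)) \<longlonglongrightarrow> L" using lim by (simp only: Y_def)
  then have Y0: "Y \<longlonglongrightarrow> L" by (rule LIMSEQ_imp_Suc)
  have F: "(\<lambda>m. real m / real (Suc m)) \<longlonglongrightarrow> 1" by (rule LIMSEQ_n_over_Suc_n)
  have l: "(\<lambda>m. Y m * (real m / real (Suc m))\<^sup>2) \<longlonglongrightarrow> L * 1\<^sup>2"
    by (intro tendsto_intros Y0 F)
  have u: "(\<lambda>m. Y (Suc m) / (real m / real (Suc m))\<^sup>2) \<longlonglongrightarrow> L / 1\<^sup>2"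
    by (intro tendsto_intros Y1 F) simp
  have top: "filterlim floor_sqrt at_top sequentially"
    unfolding filterlim_at_top
  proof
    fix Z
    show "\<forall>\<^sub>F n in sequentially. Z \<le> floor_sqrt n"
      using eventually_ge_at_top[of "Z\<^sup>2"] by eventually_elim (rule le_floor_sqrtI)
  qed
  show ?thesis
  proof (rule tendsto_sandwich)
    show "(\<lambda>n. Y (floor_sqrt n) * (real (floor_sqrt n) / real (Suc (floor_sqrt n)))\<^sup>2) \<longlonglongrightarrow> L"
      using filterlim_compose[OF l top] by simp
    show "(\<lambda>n. Y (Suc (floor_sqrt n)) / (real (floor_sqrt n) / real (Suc (floor_sqrt n)))\<^sup>2) \<longlonglongrightarrow> L"
      using filterlim_compose[OF u top] by simp
    show "\<forall>\<^sub>F n in sequentially. Y (floor_sqrt n) * (real (floor_sqrt n) / real (Suc (floor_sqrt n)))\<^sup>2 \<le> R n / real n"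
      using eventually_ge_at_top[of 1]
    proof eventually_elim
      case (elim n)
      let ?m = "floor_sqrt n"
      have m: "?m > 0" using elim by simp
      have "Y ?m * (real ?m / real (Suc ?m))\<^sup>2 = R (?m\<^sup>2) / (real (Suc ?m))\<^sup>2"
        using m by (simp add: Y_def power_divide)
      also have "\<dots> \<le> R n / real n"
      proof (intro frac_le mono nonneg)
        have "n \<le> (Suc ?m)\<^sup>2" using Suc_floor_sqrt_power2_gt[of n] by simp
        then show "real n \<le> (real (Suc ?m))\<^sup>2" by (metis of_nat_le_iff of_nat_power)
      qed (use elim in auto)
      finally show ?case .
    qed
    show "\<forall>\<^sub>F n in sequentially. R n / real n \<le> Y (Suc (floor_sqrt n)) / (real (floor_sqrt n) / real (Suc (floor_sqrt n)))\<^sup>2"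
      using eventually_ge_at_top[of 1]
    proof eventually_elim
      case (elim n)
      let ?m = "floor_sqrt n"
      have m: "?m > 0" using elim by simp
      have "R n / real n \<le> R ((Suc ?m)\<^sup>2) / (real ?m)\<^sup>2"
      proof (intro frac_le mono nonneg)
        show "n \<le> (Suc ?m)\<^sup>2" using Suc_floor_sqrt_power2_gt[of n] by simp
        show "(real ?m)\<^sup>2 \<le> real n" by (metis floor_sqrt_power2_le of_nat_le_iff of_nat_power)
      qed (use m in auto)
      also have "\<dots> = Y (Suc ?m) / (real ?m / real (Suc ?m))\<^sup>2"
        by (simp add: Y_def power_divide del: of_nat_Suc)
      finally show ?case .
    qed
  qed
qed

lemma AE_ret_sum: "AE x in unif. (\<lambda>n. ret_sum x n / real n) \<longlonglongrightarrow> ln 2"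
  using AE_psi_sum_squares
proof eventually_elim
  case (elim x)
  have "psi_sum n x = real n * ln 2 - ret_sum x n" for n
    by (simp add: psi_sum_def ret_sum_def psi_def sum_subtractf)
  then have "psi_sum ((Suc m)\<^sup>2) x / real ((Suc m)\<^sup>2) = ln 2 - ret_sum x ((Suc m)\<^sup>2) / real ((Suc m)\<^sup>2)" for m
    by (simp add: diff_divide_distrib del: of_nat_Suc of_nat_power)
  with elim have "(\<lambda>m. ln 2 - ret_sum x ((Suc m)\<^sup>2) / real ((Suc m)\<^sup>2)) \<longlonglongrightarrow> 0" by simp
  then have "(\<lambda>m. ln 2 - (ln 2 - ret_sum x ((Suc m)\<^sup>2) / real ((Suc m)\<^sup>2))) \<longlonglongrightarrow> ln 2 - 0"
    by (intro tendsto_diff tendsto_const)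
  then show ?case
    by (intro LIMSEQ_average_from_squares) (auto intro: ret_sum_mono ret_sum_nonneg)
qed

section \<open>Transfer to the parameter \<open>c\<close>\<close>

lemma mstar_eq:
  assumes nz: "\<And>k. k \<ge> 1 \<Longrightarrow> sd (2 ^ k * (1/2 - c) - (1/2 - c)) \<noteq> 0"
    and lim: "(\<lambda>n. ret_sum (1/2 - c) n / real n) \<longlonglongrightarrow> L"
  shows "mstar c = - ereal L"
proof -
  define b where "b = 1/2 - c"
  have "ereal (1 / real n) * (\<Sum>k=1..n. logsin (2 ^ k * b - b)) = ereal (- (ret_sum b n / real n))" for n
  proof -
    have "(\<Sum>k=1..n. logsin (2 ^ k * b - b)) = (\<Sum>k=1..n. ereal (- phi (2 ^ k * b - b)))"
      using nz by (intro sum.cong) (auto simp: logsin_conv_sd b_def)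
    also have "\<dots> = ereal (- ret_sum b n)" by (subst sum_ereal) (simp add: ret_sum_def sum_negf)
    finally show ?thesis by simp
  qed
  then have "mstar c = liminf (\<lambda>n. ereal (- (ret_sum b n / real n)))"
    by (simp add: mstar_def b_def Let_def)
  also have "\<dots> = ereal (- L)"
    using tendsto_minus[OF lim] by (intro lim_imp_Liminf) (auto simp: b_def)
  finally show ?thesis by simp
qed

text \<open>For \<open>c\<close> in [0,1) the point \<open>1/2 - c\<close> runs through (-1/2, 1/2],
  while the almost sure statement lives on [0,1). The property passes from \<open>b + 1\<close> to
  \<open>b\<close>, so the two reflections \<open>1/2 - c\<close> and \<open>3/2 - c\<close> pull
  the exceptional null set back to a null set of parameters.\<close>

lemma AE_mstar: "AE c in lborel. c \<in> {0..<1} \<longrightarrow> mstar c = - ereal (ln 2)"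
proof -
  define P where "P = (\<lambda>b. (\<forall>k\<ge>1. sd (2 ^ k * b - b) \<noteq> 0) \<and> (\<lambda>n. ret_sum b n / real n) \<longlonglongrightarrow> ln 2)"
  have per: "P b" if "P (b + 1)" for b
  proof -
    have "sd (2 ^ k * (b + 1) - (b + 1)) = sd (2 ^ k * b - b)" for k
    proof (rule sd_cong_Ints)
      have "2 ^ k * (b + 1) - (b + 1) - (2 ^ k * b - b) = of_int (2 ^ k - 1)" by (simp add: algebra_simps)
      then show "2 ^ k * (b + 1) - (b + 1) - (2 ^ k * b - b) \<in> \<int>" by (metis Ints_of_int)
    qed
    then show ?thesis using that by (simp add: P_def ret_sum_def phi_def)
  qed
  have "AE x in lborel. \<forall>k. k \<ge> 1 \<longrightarrow> sd (2 ^ k * x - x) \<noteq> 0"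
    unfolding AE_all_countable
  proof
    fix k
    show "AE x in lborel. k \<ge> 1 \<longrightarrow> sd (2 ^ k * x - x) \<noteq> 0"
    proof (cases "k \<ge> 1")
      case True
      then have "(2::real) ^ 1 \<le> 2 ^ k" by (intro power_increasing) auto
      then have "AE x in lborel. sd ((2 ^ k - 1) * x + 0) \<noteq> 0" by (intro AE_sd_affine_nonzero) auto
      then show ?thesis by (simp add: left_diff_distrib)
    qed simp
  qed
  moreover have "AE x in lborel. x \<in> {0..<1} \<longrightarrow> (\<lambda>n. ret_sum x n / real n) \<longlonglongrightarrow> ln 2"
    using AE_ret_sum by (simp only: AE_unif_iff)
  ultimately have "AE x in lborel. x \<in> {0..<1} \<longrightarrow> P x" by eventually_elim (auto simp: P_def)
  then obtain N where N: "N \<in> null_sets lborel" "{x \<in> space lborel. \<not> (x \<in> {0..<1} \<longrightarrow> P x)} \<subseteq> N"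
    unfolding eventually_ae_filter by blast
  then have N1: "P x" if "x \<notin> N" "x \<in> {0..<1}" for x using that by auto
  have [measurable]: "N \<in> sets borel" using N(1) by (simp add: null_sets_def)
  have refl: "AE c in lborel. t + (- 1) * c \<notin> N" for t :: real
    using AE_not_in[OF N(1)] by (intro AE_borel_affine[where P = "\<lambda>x. x \<notin> N"]) auto
  show ?thesis
    using refl[of "1/2"] refl[of "3/2"]
  proof eventually_elim
    case (elim c)
    show ?case
    proof
      assume c: "c \<in> {0..<1}"
      have "P (1/2 - c)"
      proof (cases "c \<le> 1/2")
        case True
        then show ?thesis using N1[of "1/2 - c"] elim c by auto
      next
        case False
        then have "P (1/2 - c + 1)" using N1[of "1/2 - c + 1"] elim c by auto
        then show ?thesis by (rule per)
      qed
      then show "mstar c = - ereal (ln 2)" by (intro mstar_eq) (auto simp: P_def)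
    qed
  qed
qed

section \<open>The main theorem\<close>

theorem theoremA:
  shows "(\<forall>c \<in> {0..<1}. alpha c = - \<infinity> \<longleftrightarrow> mstar c = - \<infinity>)
    \<and> (\<forall>c \<in> {0..<1}. periodic_pt (1/2 - c) \<longrightarrow> alpha c = - \<infinity>)
    \<and> (\<forall>c \<in> {0..<1}. preperiodic_pt (1/2 - c) \<and> \<not> periodic_pt (1/2 - c) \<longrightarrow> alpha c > - \<infinity>)
    \<and> meagre_in (top_of_set {0..<1}) ({0..<1} - {c. alpha c = - \<infinity>})
    \<and> (AE c in lborel. c \<in> {0..<1} \<longrightarrow> mstar c = - ereal (ln 2))
    \<and> hausdorff_dim {c \<in> {0..<1}. alpha c = - \<infinity>} = 0"
proof (intro conjI ballI impI)
  fix c :: real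
  show "alpha c = - \<infinity> \<longleftrightarrow> mstar c = - \<infinity>"
    using alpha_eq_MInf_iff[of c] mstar_ne_MInf_iff[of c] by blast
  show "alpha c = - \<infinity>" if "periodic_pt (1/2 - c)"
    using that controlled_not_periodic alpha_eq_MInf_iff by blast
  show "alpha c > - \<infinity>" if "preperiodic_pt (1/2 - c) \<and> \<not> periodic_pt (1/2 - c)"
    using that preperiodic_controlled[of "1/2 - c"] alpha_ne_MInf[of c] by (auto simp: less_le)
next
  show "meagre_in (top_of_set {0..<1}) ({0..<1} - {c. alpha c = - \<infinity>})" by (rule meagre_alpha_finite)
  show "AE c in lborel. c \<in> {0..<1} \<longrightarrow> mstar c = - ereal (ln 2)" by (rule AE_mstar)
  show "hausdorff_dim {c \<in> {0..<1}. alpha c = - \<infinity>} = 0"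
    using hausdorff_dim_uncontrolled by (simp only: alpha_eq_MInf_iff)
qed

end
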